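(* Let $S=\{z\in\mathbb{C}:|z|=1\}$ and let $f:S\to\mathbb{C}$ be a $C^\infty$ function. If $f$ belongs to a Gevrey class $G\{L_j\}$, where $L_j\ge j$ satisfies $L_j=o(j^2)$ as $j\to\infty$, then the graph $\Gamma_f=\{(z,f(z))\in\mathbb{C}^2:z\in S\}$ is pluripolar in $\mathbb{C}^2$.
   Context: Pluripolar: a set $K\subset\mathbb{C}^n$ is pluripolar if there is a plurisubharmonic function $u\not\equiv-\infty$ on $\mathbb{C}^n$ which is equal to $-\infty$ on $K$. For a $C^\infty$ function $f:S\to\mathbb{C}$ put $\widetilde f(\theta)=f(e^{i\theta})$ and, for $j\ge0$, $M_j(f)=\left(\frac1{2\pi}\int_0^{2\pi}|\widetilde f^{(j)}(\theta)|^2\,d\theta\right)^{1/2}$. Gevrey class: let $\{L_j\}$ be a sequence such that $j\le L_j\le CL_{j-1}$ holds for all $j>0$ with some constant $C>0$ independent of $j$. The Gevrey class $G\{L_j\}$ consists of all $C^\infty$ functions $f:S\to\mathbb{C}$ which satisfy $M_j(f)\le (C'L_j)^j$ for all $j$, where the constant $C'>0$ depends on $f$. *)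

theory Defs
  imports "HOL-Analysis.Analysis" "HOL-Library.Landau_Symbols"
begin

section \<open>Pluripolar sets\<close>

definition usc :: "('a::topological_space \<Rightarrow> ereal) \<Rightarrow> bool" where
  "usc u \<longleftrightarrow> (\<forall>c. open {x. u x < c})"

text \<open>
  The mean value of \<open>g\<close> over \<open>[0, 2\<pi>]\<close>, as the difference of the means of its positive and
  negative parts (\<^const>\<open>e2ennreal\<close> sends negative numbers to \<open>0\<close>). If \<open>g\<close> comes from an upper
  semicontinuous function with values in \<open>[-\<infinity>, \<infinity>)\<close> on a circle, the first integral is finite, so
  the form \<open>\<infinity> - \<infinity>\<close> does not occur and the value lies in \<open>[-\<infinity>, \<infinity>)\<close>.
\<close>

definition angular_mean :: "(real \<Rightarrow> ereal) \<Rightarrow> ereal" where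
  "angular_mean g =
     (enn2ereal (\<integral>\<^sup>+\<theta>\<in>{0..2 * pi}. e2ennreal (g \<theta>) \<partial>lborel)
      - enn2ereal (\<integral>\<^sup>+\<theta>\<in>{0..2 * pi}. e2ennreal (- g \<theta>) \<partial>lborel)) / ereal (2 * pi)"

text \<open>The constant \<open>-\<infinity>\<close> is admitted as a subharmonic and as a plurisubharmonic function.\<close>

definition subharmonic :: "(complex \<Rightarrow> ereal) \<Rightarrow> bool" where
  "subharmonic u \<longleftrightarrow>
     (\<forall>z. u z < \<infinity>) \<and> usc u \<and>
     (\<forall>z. \<forall>r>0. u z \<le> angular_mean (\<lambda>\<theta>. u (z + of_real r * cis \<theta>)))"

definition plurisubharmonic :: "(complex ^ 'n \<Rightarrow> ereal) \<Rightarrow> bool" where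
  "plurisubharmonic u \<longleftrightarrow>
     (\<forall>z. u z < \<infinity>) \<and> usc u \<and> (\<forall>a b. subharmonic (\<lambda>\<zeta>. u (a + \<zeta> *s b)))"

definition pluripolar :: "(complex ^ 'n) set \<Rightarrow> bool" where
  "pluripolar K \<longleftrightarrow>
     (\<exists>u. plurisubharmonic u \<and> (\<exists>z. u z \<noteq> - \<infinity>) \<and> (\<forall>z\<in>K. u z = - \<infinity>))"

section \<open>Smooth functions on the unit circle and Gevrey classes\<close>

text \<open>
  A function \<open>S \<rightarrow> \<complex>\<close> is represented by a total function on \<open>\<complex>\<close>; everything below depends only
  on its values on the unit circle.
\<close>

definition circle_lift :: "(complex \<Rightarrow> complex) \<Rightarrow> real \<Rightarrow> complex" where
  "circle_lift f = (\<lambda>\<theta>. f (cis \<theta>))"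

definition nth_vector_derivative :: "nat \<Rightarrow> (real \<Rightarrow> complex) \<Rightarrow> real \<Rightarrow> complex" where
  "nth_vector_derivative j = (\<lambda>g t. vector_derivative g (at t)) ^^ j"

text \<open>
  Since \<open>\<theta> \<mapsto> e\<^sup>i\<^sup>\<theta>\<close> is a local diffeomorphism onto the circle, \<open>f\<close> is \<open>C\<^sup>\<infinity>\<close> there iff its lift
  is \<open>C\<^sup>\<infinity>\<close> on the real line.
\<close>

definition smooth_on_circle :: "(complex \<Rightarrow> complex) \<Rightarrow> bool" where
  "smooth_on_circle f \<longleftrightarrow>
     (\<forall>j t. nth_vector_derivative j (circle_lift f) differentiable at t)"

definition gevrey_M :: "nat \<Rightarrow> (complex \<Rightarrow> complex) \<Rightarrow> real" where
  "gevrey_M j f =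
     sqrt (1 / (2 * pi) *
       integral {0..2 * pi} (\<lambda>\<theta>. (cmod (nth_vector_derivative j (circle_lift f) \<theta>))\<^sup>2))"

definition gevrey_sequence :: "(nat \<Rightarrow> real) \<Rightarrow> bool" where
  "gevrey_sequence L \<longleftrightarrow> (\<exists>C>0. \<forall>j>0. real j \<le> L j \<and> L j \<le> C * L (j - 1))"

text \<open>Pitfall: for \<open>j = 0\<close> the bound reads \<open>M\<^sub>0(f) \<le> 1\<close>.\<close>

definition gevrey_class :: "(nat \<Rightarrow> real) \<Rightarrow> (complex \<Rightarrow> complex) set" where
  "gevrey_class L =
     {f. smooth_on_circle f \<and> (\<exists>C>0. \<forall>j. gevrey_M j f \<le> (C * L j) ^ j)}"

definition circle_graph :: "(complex \<Rightarrow> complex) \<Rightarrow> (complex ^ 2) set" where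
  "circle_graph f = {vector [z, f z] | z. cmod z = 1}"

end

theory Submission
  imports Defs "HOL-Complex_Analysis.Complex_Analysis"
    "HOL-Computational_Algebra.Fundamental_Theorem_Algebra"
begin

text \<open>
  The condition \<open>L\<^sub>j = o(j\<^sup>2)\<close> makes the Fourier coefficients of \<open>f\<close> decay faster than
  \<open>exp (- A * sqrt \<bar>k\<bar>)\<close> for every \<open>A\<close>. A polynomial \<open>P\<close> of degree at most \<open>n\<close> in each variable
  has \<open>(n + 1)\<^sup>2\<close> coefficients, so a nonzero \<open>P\<close> exists for which the Fourier coefficients of
  \<open>P(z, f(z))\<close> vanish at all frequencies up to about \<open>n\<^sup>2 / 2\<close>; the remaining ones make
  \<open>\<bar>P\<bar> \<le> exp (- A' * n)\<close> on the graph, with \<open>A'\<close> as large as desired. A suitable weighted sum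
  of the functions \<open>(1/n) * ln \<bar>P\<bar>\<close> is plurisubharmonic, equal to \<open>- \<infinity>\<close> on the graph, and
  not identically \<open>- \<infinity>\<close>.
\<close>

section \<open>Logarithms of polynomials on circles\<close>

text \<open>The exponents match because about n^2 / 2 frequencies can be removed, and decay
  \<open>exp (- A * sqrt m)\<close> at m of size n^2 / 2 is exponential in n. The obstacle is that P
  contains powers \<open>f ^ b\<close> with b up to n, whose weighted norms grow like the b-th power
  of the norm of f. If that norm grew with A, its n-th power would consume the gain. The weight is
  therefore made equal to 1 on the first N frequencies, N depending on A; the norm of f then has a
  bound F independent of A. As sqrt is subadditive, such weights are submultiplicative up to a shift
  of the cutoff by N per factor. At most 2 * n factors cost 2 * n * N frequencies, few against n^2 /
  2 once n is large compared with N. The second difficulty is that a polynomial small on the graph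
  might be small everywhere. Normalizing its largest coefficient to modulus 1 prevents this: by
  Cauchy's estimates every ball contains a point with |P| > exp (- C n), where C depends on the ball
  only.\<close>

definition log_gap :: "real \<Rightarrow> complex \<Rightarrow> ennreal" where
  "log_gap B w = (if w = 0 then top else ennreal (B - ln (cmod w)))"

lemma log_gap_0 [simp]: "log_gap B 0 = top"
  by (simp add: log_gap_def)

text \<open>In [0, \<infinity>] a zero is an ordinary point with gap \<open>top\<close>, so
  integrals and series of gaps need no integrability conditions. The cutoff of negative values by
  \<open>ennreal\<close> is continuous, and inactive as long as
  \<open>cmod w \<le> exp B\<close>.\<close>

lemma isCont_log_gap: "isCont (log_gap B) w"
proof (cases "w = 0")
  case False
  have "((\<lambda>w. ennreal (B - ln (cmod w))) \<longlongrightarrow> ennreal (B - ln (cmod w))) (at w)"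
    by (intro tendsto_intros) (use False in auto)
  moreover have "\<forall>\<^sub>F x in at w. log_gap B x = ennreal (B - ln (cmod x))"
    using eventually_neq_at_within[of 0 w UNIV]
    by eventually_elim (simp add: log_gap_def)
  ultimately show ?thesis
    using False unfolding isCont_def by (subst tendsto_cong) (auto simp: log_gap_def[of B w])
next
  case True
  have "(log_gap B \<longlongrightarrow> top) (at 0)"
    unfolding tendsto_top_iff_ennreal
  proof (intro allI impI)
    fix l :: real assume "0 \<le> l"
    have "\<forall>\<^sub>F x in at (0::complex). dist x 0 < exp (B - l - 1)"
      unfolding eventually_at by (intro exI[of _ "exp (B - l - 1)"]) auto
    then show "\<forall>\<^sub>F x in at 0. ennreal l < log_gap B x"
    proof eventually_elim
      case (elim x)
      show ?case
      proof (cases "x = 0")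
        case False
        have "ln (cmod x) < B - l - 1"
          using elim False by (metis dist_0_norm dist_commute exp_less_cancel_iff exp_ln zero_less_norm_iff)
        then have "l < B - ln (cmod x)" by simp
        then show ?thesis using False \<open>0 \<le> l\<close> by (simp add: log_gap_def ennreal_less_iff)
      qed auto
    qed
  qed
  then show ?thesis using True by (simp add: isCont_def)
qed

lemma continuous_on_log_gap [continuous_intros]:
  "continuous_on A g \<Longrightarrow> continuous_on A (\<lambda>x. log_gap B (g x))"
  using continuous_on_compose2[of UNIV "log_gap B" A g] isCont_log_gap
  by (auto simp: continuous_at_imp_continuous_on)

lemma log_gap_cong: "cmod w = cmod w' \<Longrightarrow> log_gap B w = log_gap B w'"
  by (auto simp: log_gap_def)

lemma ln_le_of_le_exp: "x \<noteq> 0 \<Longrightarrow> cmod x \<le> exp B \<Longrightarrow> ln (cmod x) \<le> B"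
  by (metis exp_le_cancel_iff exp_ln zero_less_norm_iff)

text \<open>The bounds make both gaps nonnegative, so \<open>ennreal\<close> cuts off nothing and
  the additivity of the logarithm survives; a zero factor makes both sides
  \<open>top\<close>.\<close>

lemma log_gap_mult:
  assumes "cmod v \<le> exp A" "cmod w \<le> exp B"
  shows "log_gap (A + B) (v * w) = log_gap A v + log_gap B w"
  using assms
  by (auto simp: log_gap_def norm_mult ln_mult ln_le_of_le_exp simp flip: ennreal_plus
      intro!: arg_cong[of _ _ ennreal])

lemma log_gap_shift:
  assumes "cmod w \<le> exp B" "0 \<le> t"
  shows "log_gap (B + t) w = log_gap B w + ennreal t"
  using assms
  by (auto simp: log_gap_def ln_le_of_le_exp simp flip: ennreal_plus
      intro!: arg_cong[of _ _ ennreal])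

text \<open>For |u| \<le> 1 the point r - s u stays in the open right half-plane, where
  \<open>Ln\<close> is holomorphic. Cauchy's formula at u = 0 then yields the mean value property of
  the harmonic function ln |r - s u|.\<close>

lemma has_integral_ln_cmod_circle:
  assumes s: "cmod s < r"
  shows "((\<lambda>\<theta>. ln (cmod (of_real r - s * cis \<theta>))) has_integral (2 * pi * ln r)) {0..2 * pi}"
proof -
  have r: "0 < r" using s by (meson norm_ge_zero order_le_less_trans)
  have Re: "0 < Re (of_real r - s * u)" if "cmod u \<le> 1" for u
  proof -
    have "cmod (s * u) \<le> cmod s * 1"
      unfolding norm_mult by (rule mult_left_mono) (use that in auto)
    then show ?thesis using s complex_Re_le_cmod[of "s * u"] by simp
  qed
  have "((\<lambda>u. Ln (of_real r - s * u) / (u - 0)) has_contour_integral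
      (2 * of_real pi * \<i> * Ln (of_real r - s * 0))) (circlepath 0 1)"
  proof (rule Cauchy_integral_circlepath_simple)
    show "(\<lambda>u. Ln (of_real r - s * u)) holomorphic_on cball 0 1"
    proof (intro holomorphic_intros)
      fix u :: complex assume "u \<in> cball 0 1"
      then show "of_real r - s * u \<notin> \<real>\<^sub>\<le>\<^sub>0"
        using Re[of u] by (auto simp: complex_nonpos_Reals_iff)
    qed
  qed simp
  then have "((\<lambda>t. Ln (of_real r - s * cis t) / cis t * \<i> * cis t) has_integral
      (2 * of_real pi * \<i> * Ln (of_real r))) {0..2 * pi}"
    by (simp add: circlepath_def has_contour_integral_part_circlepath_iff)
  then have "((\<lambda>t. Ln (of_real r - s * cis t) * \<i>) has_integral
      (2 * of_real pi * \<i> * Ln (of_real r))) {0..2 * pi}"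
    by (rule has_integral_eq[rotated]) (simp add: cis_neq_zero)
  \<comment> \<open>Since du / u = i dt, the formula carries a factor i, and Im (i * Ln) is Re Ln,
    the logarithm of the modulus.\<close>
  then have "((\<lambda>t. Im (Ln (of_real r - s * cis t) * \<i>)) has_integral
      Im (2 * of_real pi * \<i> * Ln (of_real r))) {0..2 * pi}"
    by (drule_tac has_integral_linear[OF _ bounded_linear_Im]) (simp add: o_def)
  then have "((\<lambda>t. Re (Ln (of_real r - s * cis t))) has_integral (2 * pi * ln r)) {0..2 * pi}"
    using r by (simp add: Ln_of_real)
  then show ?thesis
  proof (rule has_integral_eq[rotated])
    fix t
    have "of_real r - s * cis t \<noteq> 0" using Re[of "cis t"] by (metis less_irrefl norm_cis order_refl zero_complex.sel(1))
    then show "Re (Ln (of_real r - s * cis t)) = ln (cmod (of_real r - s * cis t))" by simp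
  qed
qed

lemma borel_measurable_log_gap_indicator:
  assumes "continuous_on UNIV g"
  shows "(\<lambda>x. log_gap B (g x) * indicator {a..b::real} x) \<in> borel_measurable lborel"
proof -
  have "(\<lambda>x. log_gap B (g x)) \<in> borel_measurable borel"
    by (intro borel_measurable_continuous_onI continuous_on_log_gap assms)
  then show ?thesis by simp
qed

text \<open>The case \<open>\<bar>s\<bar> = r\<close>, where the logarithm has a pole on the circle, is reached by Fatou's lemma.\<close>

lemma nn_integral_log_gap_circle_aux:
  assumes s: "cmod s \<le> r" and r: "0 < r" and B: "ln (2 * r) \<le> B"
  shows "(\<integral>\<^sup>+\<theta>\<in>{0..2 * pi}. log_gap B (of_real r - s * cis \<theta>) \<partial>lborel) \<le> ennreal (2 * pi * (B - ln r))"
proof -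
  \<comment> \<open>Shrinking s moves the zero off the circle; with \<open>+ 2\<close> the factor
    lies in [1/2, 1) already for \<open>n = 0\<close>.\<close>
  define S where "S n = of_real (1 - 1 / (real n + 2)) * s" for n
  have S: "cmod (S n) < r" for n
  proof -
    have "cmod (S n) = (1 - 1 / (real n + 2)) * cmod s"
      by (simp add: S_def norm_mult del: of_real_diff of_real_divide of_real_add)
    also have "\<dots> \<le> (1 - 1 / (real n + 2)) * r" using s by (intro mult_left_mono) auto
    also have "\<dots> < 1 * r" using r by (intro mult_strict_right_mono) auto
    finally show ?thesis by simp
  qed
  have S_lim: "S \<longlonglongrightarrow> s"
  proof -
    have "(\<lambda>n. 1 - 1 / (real n + 2)) \<longlonglongrightarrow> 1" by real_asymp
    then have "S \<longlonglongrightarrow> of_real 1 * s" unfolding S_def by (intro tendsto_intros)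
    then show ?thesis by simp
  qed
  let ?f = "\<lambda>n \<theta>. log_gap B (of_real r - S n * cis \<theta>) * indicator {0..2 * pi} \<theta>"
  have eq: "integral\<^sup>N lborel (?f n) = ennreal (2 * pi * (B - ln r))" for n
  proof -
    have nz: "of_real r - S n * cis \<theta> \<noteq> 0" for \<theta>
    proof
      assume "of_real r - S n * cis \<theta> = 0"
      then have "cmod (of_real r) = cmod (S n * cis \<theta>)" by simp
      then show False using S[of n] r by (simp add: norm_mult)
    qed
    have le: "ln (cmod (of_real r - S n * cis \<theta>)) \<le> B" for \<theta>
    proof -
      have "cmod (of_real r - S n * cis \<theta>) \<le> cmod (of_real r) + cmod (S n * cis \<theta>)"
        by (rule norm_triangle_ineq4)
      also have "\<dots> \<le> 2 * r" using S[of n] r by (simp add: norm_mult)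
      finally have "ln (cmod (of_real r - S n * cis \<theta>)) \<le> ln (2 * r)" using nz r by simp
      then show ?thesis using B by simp
    qed
    have "((\<lambda>\<theta>. B - ln (cmod (of_real r - S n * cis \<theta>))) has_integral ((2 * pi - 0) *\<^sub>R B - 2 * pi * ln r)) {0..2 * pi}"
      by (intro has_integral_diff has_integral_ln_cmod_circle S)
        (use has_integral_const_real[of B 0 "2 * pi"] in simp)
    then have "(\<integral>\<^sup>+\<theta>. ennreal (B - ln (cmod (of_real r - S n * cis \<theta>))) * indicator {0..2 * pi} \<theta> \<partial>lborel)
       = ennreal ((2 * pi - 0) *\<^sub>R B - 2 * pi * ln r)"
      by (intro nn_integral_has_integral_lebesgue') (use le in auto)
    then show ?thesis using nz by (simp add: log_gap_def algebra_simps)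
  qed
  have "(\<lambda>n. ?f n \<theta>) \<longlonglongrightarrow> log_gap B (of_real r - s * cis \<theta>) * indicator {0..2 * pi} \<theta>" for \<theta>
  proof -
    have "(\<lambda>n. log_gap B (of_real r - S n * cis \<theta>)) \<longlonglongrightarrow> log_gap B (of_real r - s * cis \<theta>)"
      by (rule isCont_tendsto_compose[OF isCont_log_gap]) (intro tendsto_intros S_lim)
    then show ?thesis by (cases "\<theta> \<in> {0..2 * pi}") auto
  qed
  then have "(\<integral>\<^sup>+\<theta>\<in>{0..2 * pi}. log_gap B (of_real r - s * cis \<theta>) \<partial>lborel) = (\<integral>\<^sup>+\<theta>. liminf (\<lambda>n. ?f n \<theta>) \<partial>lborel)"
    by (intro nn_integral_cong lim_imp_Liminf[symmetric]) auto
  also have "\<dots> \<le> liminf (\<lambda>n. integral\<^sup>N lborel (?f n))"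
    by (intro nn_integral_liminf borel_measurable_log_gap_indicator continuous_intros)
  also have "\<dots> = ennreal (2 * pi * (B - ln r))" by (simp add: eq Liminf_const)
  finally show ?thesis .
qed

text \<open>By Jensen's formula the mean of ln |s + r e^(i \<theta>)| is the larger of ln |s| and ln
  r, hence at least ln |s|. The preceding lemma is applied with the larger of |s| and r as its
  radius; the factor 2 in the hypothesis pays for its condition
  \<open>ln (2 * r) \<le> B\<close>.\<close>

lemma nn_integral_log_gap_linear:
  fixes s :: complex
  assumes r: "0 < r" and B: "2 * (cmod s + r) \<le> exp B"
  shows "(\<integral>\<^sup>+\<theta>\<in>{0..2 * pi}. log_gap B (s + of_real r * cis \<theta>) \<partial>lborel) \<le> ennreal (2 * pi) * log_gap B s"
proof (cases "s = 0")
  case True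
  then show ?thesis by (simp add: ennreal_mult_top)
next
  case False
  have ln2: "ln (2 * t) \<le> B" if "0 < t" "t \<le> cmod s + r" for t
  proof -
    have "ln (2 * t) \<le> ln (exp B)"
      by (subst ln_le_cancel_iff) (use that B in auto)
    then show ?thesis by simp
  qed
  have ln1: "ln t \<le> B" if "0 < t" "t \<le> cmod s + r" for t
  proof -
    have "ln t \<le> ln (2 * t)" by (subst ln_le_cancel_iff) (use that in auto)
    then show ?thesis using ln2[OF that] by simp
  qed
  show ?thesis
  proof (cases "cmod s \<le> r")
    case True
    have "log_gap B (s + of_real r * cis \<theta>) = log_gap B (of_real r - (- cnj s) * cis \<theta>)" for \<theta>
    proof (rule log_gap_cong)
      \<comment> \<open>Conjugation and a unimodular factor leave the modulus unchanged.\<close>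
      have "of_real r - (- cnj s) * cis \<theta> = cnj (s + of_real r * cis \<theta>) * cis \<theta>"
        by (simp add: algebra_simps cis_cnj cis_mult)
      then show "cmod (s + of_real r * cis \<theta>) = cmod (of_real r - (- cnj s) * cis \<theta>)"
        by (metis complex_mod_cnj mult.right_neutral norm_cis norm_mult)
    qed
    then have "(\<integral>\<^sup>+\<theta>\<in>{0..2 * pi}. log_gap B (s + of_real r * cis \<theta>) \<partial>lborel) \<le> ennreal (2 * pi * (B - ln r))"
      using nn_integral_log_gap_circle_aux[of "- cnj s" r B] True r ln2[of r] by simp
    also have "\<dots> \<le> ennreal (2 * pi * (B - ln (cmod s)))"
      by (intro ennreal_leI mult_left_mono) (use True False r in auto)
    also have "\<dots> = ennreal (2 * pi) * log_gap B s"
      using False ln1[of "cmod s"] r by (simp add: log_gap_def ennreal_mult)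
    finally show ?thesis .
  next
    case gt: False
    have eq: "log_gap B (s + of_real r * cis \<theta>) = log_gap B (of_real (cmod s) - (- of_real r * of_real (cmod s) / s) * cis \<theta>)" for \<theta>
    proof (rule log_gap_cong)
      \<comment> \<open>The unimodular factor |s| / s makes the constant term positive, so that |s|
        takes over the part of r.\<close>
      have "of_real (cmod s) - (- of_real r * of_real (cmod s) / s) * cis \<theta> = (s + of_real r * cis \<theta>) * (of_real (cmod s) / s)"
        using False by (simp add: field_simps)
      moreover have "cmod (of_real (cmod s) / s) = 1" using False by (simp add: norm_divide)
      ultimately show "cmod (s + of_real r * cis \<theta>) = cmod (of_real (cmod s) - (- of_real r * of_real (cmod s) / s) * cis \<theta>)"
        by (simp only: norm_mult mult_1_right)
    qed
    have "(\<integral>\<^sup>+\<theta>\<in>{0..2 * pi}. log_gap B (s + of_real r * cis \<theta>) \<partial>lborel) \<le> ennreal (2 * pi * (B - ln (cmod s)))"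
      unfolding eq
      by (rule nn_integral_log_gap_circle_aux) (use gt r False ln2[of "cmod s"] in \<open>auto simp: norm_mult norm_divide\<close>)
    also have "\<dots> = ennreal (2 * pi) * log_gap B s"
      using False ln1[of "cmod s"] r by (simp add: log_gap_def ennreal_mult)
    finally show ?thesis .
  qed
qed

text \<open>Induction on the degree by splitting off a root: the gaps of the factors add up. The
  bound is existential because each linear factor brings its own constant.\<close>

lemma nn_integral_log_gap_poly_aux:
  fixes h :: "complex poly"
  assumes r: "0 < r"
  shows "\<exists>B. cmod (poly h a) \<le> exp B \<and> (\<forall>\<theta>. cmod (poly h (a + of_real r * cis \<theta>)) \<le> exp B) \<and>
    (\<integral>\<^sup>+\<theta>\<in>{0..2 * pi}. log_gap B (poly h (a + of_real r * cis \<theta>)) \<partial>lborel) \<le> ennreal (2 * pi) * log_gap B (poly h a)"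
proof (induction "degree h" arbitrary: h)
  case 0
  then obtain c where c: "h = [:c:]" by (metis degree_eq_zeroE)
  show ?case
    by (intro exI[of _ "ln (cmod c)"], cases "c = 0") (simp_all add: c log_gap_def ennreal_mult_top)
next
  case (Suc d)
  then obtain \<rho> where "poly h \<rho> = 0" 
    using alg_closed_imp_poly_has_root[of h] by (metis zero_less_Suc)
  then obtain q where q: "h = [:-\<rho>, 1:] * q" using poly_eq_0_iff_dvd by (metis dvdE)
  have "q \<noteq> 0" using q Suc.hyps(2) by auto
  then have "degree h = Suc (degree q)" unfolding q by (subst degree_mult_eq) auto
  then have "d = degree q" using Suc by simp
  from Suc.hyps(1)[OF this] obtain B where B: "cmod (poly q a) \<le> exp B"
    "\<And>\<theta>. cmod (poly q (a + of_real r * cis \<theta>)) \<le> exp B"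
    "(\<integral>\<^sup>+\<theta>\<in>{0..2 * pi}. log_gap B (poly q (a + of_real r * cis \<theta>)) \<partial>lborel) \<le> ennreal (2 * pi) * log_gap B (poly q a)"
    by blast
  define A where "A = ln (2 * (cmod (a - \<rho>) + r))"
  have expA: "exp A = 2 * (cmod (a - \<rho>) + r)"
    unfolding A_def by (rule exp_ln) (simp add: r add_nonneg_pos)
  have le_double: "cmod (a - \<rho>) + r \<le> 2 * (cmod (a - \<rho>) + r)"
    using r add_nonneg_nonneg[OF norm_ge_zero[of "a - \<rho>"], of r] by simp
  have A: "cmod (a - \<rho> + of_real r * cis \<theta>) \<le> exp A" for \<theta>
  proof -
    have "cmod (a - \<rho> + of_real r * cis \<theta>) \<le> cmod (a - \<rho>) + cmod (of_real r * cis \<theta>)"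
      by (rule norm_triangle_ineq)
    also have "\<dots> = cmod (a - \<rho>) + r" using r by (simp add: norm_mult)
    also have "\<dots> \<le> exp A" unfolding expA by (rule le_double)
    finally show ?thesis .
  qed
  have A0: "cmod (a - \<rho>) \<le> exp A"
    unfolding expA using r le_double by (smt (verit))
  have h: "poly h z = (z - \<rho>) * poly q z" for z by (simp add: q algebra_simps)
  have h': "poly h (a + of_real r * cis \<theta>) = (a - \<rho> + of_real r * cis \<theta>) * poly q (a + of_real r * cis \<theta>)" for \<theta>
    by (simp add: h algebra_simps)
  show ?case
  proof (intro exI[of _ "A + B"] conjI allI)
    show "cmod (poly h a) \<le> exp (A + B)"
      unfolding h norm_mult exp_add by (intro mult_mono B A0) auto
    show "cmod (poly h (a + of_real r * cis \<theta>)) \<le> exp (A + B)" for \<theta>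
      unfolding h' norm_mult exp_add by (intro mult_mono B A) auto
    have "(\<integral>\<^sup>+\<theta>\<in>{0..2 * pi}. log_gap (A + B) (poly h (a + of_real r * cis \<theta>)) \<partial>lborel)
      = (\<integral>\<^sup>+\<theta>. log_gap A (a - \<rho> + of_real r * cis \<theta>) * indicator {0..2 * pi} \<theta>
           + log_gap B (poly q (a + of_real r * cis \<theta>)) * indicator {0..2 * pi} \<theta> \<partial>lborel)"
      unfolding h' log_gap_mult[OF A B(2)] by (simp add: distrib_right)
    also have "\<dots> = (\<integral>\<^sup>+\<theta>\<in>{0..2 * pi}. log_gap A (a - \<rho> + of_real r * cis \<theta>) \<partial>lborel)
           + (\<integral>\<^sup>+\<theta>\<in>{0..2 * pi}. log_gap B (poly q (a + of_real r * cis \<theta>)) \<partial>lborel)"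
      by (intro nn_integral_add borel_measurable_log_gap_indicator continuous_intros)
    also have "\<dots> \<le> ennreal (2 * pi) * log_gap A (a - \<rho>) + ennreal (2 * pi) * log_gap B (poly q a)"
      by (intro add_mono B(3) nn_integral_log_gap_linear r) (simp add: expA)
    also have "\<dots> = ennreal (2 * pi) * log_gap (A + B) (poly h a)"
      unfolding h log_gap_mult[OF A0 B(1)] by (simp add: distrib_left)
    finally show "(\<integral>\<^sup>+\<theta>\<in>{0..2 * pi}. log_gap (A + B) (poly h (a + of_real r * cis \<theta>)) \<partial>lborel)
       \<le> ennreal (2 * pi) * log_gap (A + B) (poly h a)" .
  qed
qed

text \<open>Raising the bound by t adds 2 \<pi> t to both sides, so one admissible bound gives all
  others; lowering it is possible because 2 \<pi> t is finite and cancels.\<close>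

lemma nn_integral_log_gap_poly:
  fixes h :: "complex poly"
  assumes r: "0 < r" and c: "cmod (poly h a) \<le> exp B"
    and B: "\<And>\<theta>. cmod (poly h (a + of_real r * cis \<theta>)) \<le> exp B"
  shows "(\<integral>\<^sup>+\<theta>\<in>{0..2 * pi}. log_gap B (poly h (a + of_real r * cis \<theta>)) \<partial>lborel) \<le> ennreal (2 * pi) * log_gap B (poly h a)"
proof -
  let ?I = "\<lambda>B. \<integral>\<^sup>+\<theta>\<in>{0..2 * pi}. log_gap B (poly h (a + of_real r * cis \<theta>)) \<partial>lborel"
  obtain B' where B': "cmod (poly h a) \<le> exp B'" "\<And>\<theta>. cmod (poly h (a + of_real r * cis \<theta>)) \<le> exp B'"
    "?I B' \<le> ennreal (2 * pi) * log_gap B' (poly h a)"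
    using nn_integral_log_gap_poly_aux[OF r, of h a] by blast
  have shift: "?I (b + t) = ?I b + ennreal (2 * pi) * ennreal t"
    if "0 \<le> t" "\<And>\<theta>. cmod (poly h (a + of_real r * cis \<theta>)) \<le> exp b" for b t
  proof -
    have "?I (b + t) = (\<integral>\<^sup>+\<theta>. log_gap b (poly h (a + of_real r * cis \<theta>)) * indicator {0..2 * pi} \<theta>
        + ennreal t * indicator {0..2 * pi} \<theta> \<partial>lborel)"
      using that by (simp add: log_gap_shift distrib_right)
    also have "\<dots> = ?I b + (\<integral>\<^sup>+\<theta>. ennreal t * indicator {0..2 * pi} \<theta> \<partial>lborel)"
      by (intro nn_integral_add borel_measurable_log_gap_indicator continuous_intros) simp
    also have "(\<integral>\<^sup>+\<theta>. ennreal t * indicator {0..2 * pi} \<theta> \<partial>lborel) = ennreal (2 * pi) * ennreal t"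
      by (simp add: nn_integral_cmult mult.commute)
    finally show ?thesis .
  qed
  show ?thesis
  proof (cases "B' \<le> B")
    case True
    define t where "t = B - B'"
    have t: "0 \<le> t" "B = B' + t" using True by (auto simp: t_def)
    show ?thesis unfolding t(2) shift[OF t(1) B'(2)] log_gap_shift[OF B'(1) t(1)] distrib_left
      using B'(3) by (rule add_right_mono)
  next
    case False
    define t where "t = B' - B"
    have t: "0 \<le> t" "B' = B + t" using False by (auto simp: t_def)
    have "?I B + ennreal (2 * pi) * ennreal t \<le> ennreal (2 * pi) * log_gap B (poly h a) + ennreal (2 * pi) * ennreal t"
      using B'(3) unfolding t(2) shift[OF t(1) B] log_gap_shift[OF c t(1)] distrib_left .
    then show ?thesis
      by (subst (asm) (1 2) add.commute) (simp add: ennreal_add_left_cancel_le ennreal_mult_eq_top_iff)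
  qed
qed

text \<open>Passage from estimates in [0, \<infinity>] to \<open>angular_mean\<close>, a difference
  of two integrals. For M - G the positive and negative parts are the truncated differences M - G
  and G - M, tied to the integral of G by \<open>P + J = ennreal (2 * pi * M) + N\<close>. Unless c
  is \<open>top\<close>, where the left-hand side is - \<infinity>, all terms are finite and the
  identity can be read in the reals.\<close>

lemma angular_mean_ge:
  fixes G :: "real \<Rightarrow> ennreal"
  assumes G: "G \<in> borel_measurable borel" and M: "0 \<le> M"
    and le: "(\<integral>\<^sup>+\<theta>\<in>{0..2 * pi}. G \<theta> \<partial>lborel) \<le> ennreal (2 * pi) * c"
  shows "ereal M - enn2ereal c \<le> angular_mean (\<lambda>\<theta>. ereal M - enn2ereal (G \<theta>))"
proof (cases "c = top")
  case True
  then show ?thesis by simp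
next
  case False
  then obtain c' where c': "c = ennreal c'" "0 \<le> c'" by (cases c) auto
  have pos: "e2ennreal (ereal M - enn2ereal x) = ennreal M - x" for x :: ennreal
    using M by (cases x) (auto simp: ennreal_minus e2ennreal_ereal e2ennreal_neg)
  have neg: "e2ennreal (- (ereal M - enn2ereal x)) = x - ennreal M" for x :: ennreal
    using M by (cases x) (auto simp: ennreal_minus e2ennreal_ereal e2ennreal_neg e2ennreal_infty)
  define P N J where "P = (\<integral>\<^sup>+\<theta>\<in>{0..2 * pi}. (ennreal M - G \<theta>) \<partial>lborel)"
    and "N = (\<integral>\<^sup>+\<theta>\<in>{0..2 * pi}. (G \<theta> - ennreal M) \<partial>lborel)"
    and "J = (\<integral>\<^sup>+\<theta>\<in>{0..2 * pi}. G \<theta> \<partial>lborel)"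
  have const: "(\<integral>\<^sup>+\<theta>. ennreal M * indicator {0..2 * pi} \<theta> \<partial>lborel) = ennreal (2 * pi * M)"
    using M by (simp add: nn_integral_cmult ennreal_mult mult.commute)
  have J: "J \<le> ennreal (2 * pi * c')" using le c' by (simp add: J_def ennreal_mult)
  have P: "P \<le> ennreal (2 * pi * M)"
    unfolding P_def const[symmetric] by (intro nn_integral_mono mult_right_mono) (auto simp: diff_le_self_ennreal)
  have eq: "P + J = ennreal (2 * pi * M) + N"
  proof -
    have "P + J = (\<integral>\<^sup>+\<theta>. (ennreal M - G \<theta>) * indicator {0..2 * pi} \<theta> + G \<theta> * indicator {0..2 * pi} \<theta> \<partial>lborel)"
      unfolding P_def J_def by (rule nn_integral_add[symmetric]) (use G in measurable)
    also have "\<dots> = (\<integral>\<^sup>+\<theta>. ennreal M * indicator {0..2 * pi} \<theta> + (G \<theta> - ennreal M) * indicator {0..2 * pi} \<theta> \<partial>lborel)"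
    proof (rule nn_integral_cong)
      fix \<theta>
      have "(ennreal M - G \<theta>) + G \<theta> = ennreal M + (G \<theta> - ennreal M)"
        using M by (cases "G \<theta>"; cases "M \<le> enn2real (G \<theta>)") (auto simp: ennreal_minus ennreal_neg simp flip: ennreal_plus)
      then show "(ennreal M - G \<theta>) * indicator {0..2 * pi} \<theta> + G \<theta> * indicator {0..2 * pi} \<theta>
        = ennreal M * indicator {0..2 * pi} \<theta> + (G \<theta> - ennreal M) * indicator {0..2 * pi} \<theta>"
        by (simp flip: distrib_right)
    qed
    also have "\<dots> = ennreal (2 * pi * M) + N"
      unfolding N_def const[symmetric] by (rule nn_integral_add) (use G in measurable)
    finally show ?thesis .
  qed
  obtain p where p: "P = ennreal p" "0 \<le> p" using P by (cases P) (auto simp: top_unique)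
  obtain q where q: "J = ennreal q" "0 \<le> q" using J by (cases J) (auto simp: top_unique)
  obtain m where m: "N = ennreal m" "0 \<le> m" using eq p q by (cases N) auto
  have "p + q = 2 * pi * M + m"
    using eq p q m M by (simp flip: ennreal_plus)
  moreover have "q \<le> 2 * pi * c'" using J q c' by simp
  ultimately have "2 * pi * (M - c') \<le> p - m" by (simp add: algebra_simps)
  then have "M - c' \<le> (p - m) / (2 * pi)" by (simp add: field_simps)
  then show ?thesis
    unfolding angular_mean_def pos neg P_def[symmetric] N_def[symmetric]
    using p m c' by (simp add: p m)
qed

section \<open>Weighted sums of logarithms\<close>

text \<open>The majorant \<open>d j * H x\<close> keeps every gap nonnegative, and
  \<open>summable_weights\<close> makes the sum of all majorants finite. In the application d j is a
  degree bound and \<open>w j * d j\<close> is at most (1/2)^j.\<close>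

locale log_series =
  fixes w d :: "nat \<Rightarrow> real" and P :: "nat \<Rightarrow> complex ^ 'n \<Rightarrow> complex" and H :: "complex ^ 'n \<Rightarrow> real"
  assumes w_nonneg: "0 \<le> w j" and d_nonneg: "0 \<le> d j"
    and summable_weights: "summable (\<lambda>j. w j * d j)"
    and continuous_P: "continuous_on UNIV (P j)" and continuous_H: "continuous_on UNIV H"
    and H_nonneg: "0 \<le> H x"
    and P_le: "cmod (P j x) \<le> exp (d j * H x)"
    and poly_on_lines: "\<exists>h. \<forall>\<zeta>. P j (a + \<zeta> *s b) = poly h \<zeta>"
begin

definition total_weight :: real where
  "total_weight = (\<Sum>j. w j * d j)"

definition gap_sum :: "real \<Rightarrow> complex ^ 'n \<Rightarrow> ennreal" where
  "gap_sum B x = (\<Sum>j. ennreal (w j) * log_gap (d j * B) (P j x))"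

text \<open>
  This is \<open>\<Sum>j. w j * ln \<bar>P j x\<bar>\<close>: for \<open>B \<ge> H x\<close> every summand is \<open>w j * d j * B\<close> minus a
  nonnegative gap, and the gaps may be summed in \<open>[0, \<infinity>]\<close>.
\<close>

definition potential :: "complex ^ 'n \<Rightarrow> ereal" where
  "potential x = ereal (total_weight * H x) - enn2ereal (gap_sum (H x) x)"

lemma total_weight_nonneg: "0 \<le> total_weight"
  unfolding total_weight_def by (intro suminf_nonneg summable_weights mult_nonneg_nonneg w_nonneg d_nonneg)

lemma P_le_mono: "H x \<le> B \<Longrightarrow> cmod (P j x) \<le> exp (d j * B)"
  using P_le[of j x] mult_left_mono[OF _ d_nonneg[of j], of "H x" B] by (meson exp_le_cancel_iff order.trans)

text \<open>Allows one constant B on a neighbourhood or a circle in place of the variable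
  \<open>H x\<close>; what remains is a constant minus a sum of nonnegative continuous
  functions.\<close>

lemma potential_eq:
  assumes "H x \<le> B"
  shows "potential x = ereal (total_weight * B) - enn2ereal (gap_sum B x)"
proof -
  define t where "t = B - H x"
  have t: "0 \<le> t" "B = H x + t" using assms by (auto simp: t_def)
  have "ennreal (w j) * log_gap (d j * B) (P j x)
      = ennreal (w j) * log_gap (d j * H x) (P j x) + ennreal (w j * d j * t)" for j
    unfolding t(2) distrib_left
    using t(1) w_nonneg[of j] d_nonneg[of j] P_le[of j x]
    by (simp add: log_gap_shift distrib_left ennreal_mult mult.assoc)
  then have "gap_sum B x = (\<Sum>j. ennreal (w j) * log_gap (d j * H x) (P j x) + ennreal (w j * d j * t))"
    by (simp add: gap_sum_def)
  also have "\<dots> = gap_sum (H x) x + (\<Sum>j. ennreal (w j * d j * t))"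
    unfolding gap_sum_def by (rule suminf_add[symmetric]) auto
  also have "(\<Sum>j. ennreal (w j * d j * t)) = ennreal (total_weight * t)"
    unfolding total_weight_def suminf_mult2[OF summable_weights]
    by (rule suminf_ennreal2) (auto intro!: mult_nonneg_nonneg w_nonneg d_nonneg t(1) summable_mult2 summable_weights)
  finally have eq: "gap_sum B x = gap_sum (H x) x + ennreal (total_weight * t)" .
  have "total_weight * B = total_weight * H x + total_weight * t" by (simp add: t(2) distrib_left)
  then show ?thesis
    unfolding potential_def eq using total_weight_nonneg t(1)
    by (cases "gap_sum (H x) x") (auto simp: algebra_simps simp flip: ennreal_plus)
qed

lemma potential_less_top: "potential x < \<infinity>"
  by (cases "gap_sum (H x) x") (auto simp: potential_def)

lemma continuous_gap: "continuous_on UNIV (\<lambda>x. ennreal (w j) * log_gap B (P j x))"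
proof -
  have "continuous_on UNIV (\<lambda>x. log_gap B (P j x))" by (intro continuous_intros continuous_P)
  then show ?thesis
    by (auto simp: continuous_on intro!: ennreal_tendsto_cmult)
qed

text \<open>A partial sum of gaps that already pushes the value at x below c does so near x, and
  further gaps only lower it. The margin 1 in \<open>B = H x + 1\<close> keeps B admissible on a
  neighbourhood of x.\<close>

lemma usc_potential: "usc potential"
  unfolding usc_def
proof (intro allI)
  fix c :: ereal
  show "open {x. potential x < c}"
  proof (subst open_subopen, safe)
    fix x assume x: "potential x < c"
    define B where "B = H x + 1"
    define g where "g J y = ereal (total_weight * B) - enn2ereal (\<Sum>j<J. ennreal (w j) * log_gap (d j * B) (P j y))" for J y
    have "(\<lambda>J. g J x) \<longlonglongrightarrow> ereal (total_weight * B) - enn2ereal (gap_sum B x)"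
      unfolding g_def gap_sum_def
      by (intro tendsto_intros tendsto_enn2erealI summable_LIMSEQ) auto
    moreover have "ereal (total_weight * B) - enn2ereal (gap_sum B x) < c"
      using x potential_eq[of x B] by (simp add: B_def)
    ultimately have "\<forall>\<^sub>F J in sequentially. g J x < c" by (rule order_tendstoD)
    then obtain J where J: "g J x < c" by (auto simp: eventually_sequentially)
    define U where "U = {y. H y < B} \<inter> {y. g J y < c}"
    have "continuous_on UNIV (\<lambda>y. \<Sum>j<J. ennreal (w j) * log_gap (d j * B) (P j y))"
      using continuous_gap by (auto simp: continuous_on intro!: tendsto_sum)
    then have "continuous_on UNIV (g J)"
      unfolding g_def by (simp add: continuous_on tendsto_diff_ereal_general)
    then have "open U"
      unfolding U_def by (intro open_Int open_Collect_less continuous_H continuous_on_const)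
    moreover have "x \<in> U" using J by (simp add: U_def B_def)
    moreover have "U \<subseteq> {x. potential x < c}"
    proof
      fix y assume y: "y \<in> U"
      have "potential y = ereal (total_weight * B) - enn2ereal (gap_sum B y)"
        using y by (intro potential_eq) (simp add: U_def)
      also have "\<dots> \<le> g J y"
        unfolding g_def gap_sum_def
        by (intro ereal_minus_mono order_refl) (simp add: sum_le_suminf flip: less_eq_ennreal.rep_eq)
      also have "\<dots> < c" using y by (simp add: U_def)
      finally show "y \<in> {x. potential x < c}" by simp
    qed
    ultimately show "\<exists>T. open T \<and> x \<in> T \<and> T \<subseteq> {x. potential x < c}" by blast
  qed
qed

text \<open>Jensen's inequality holds for each summand on the complex line, and the integral passes
  through the series because all gaps are nonnegative.\<close>

lemma subharmonic_potential_line: "subharmonic (\<lambda>\<zeta>. potential (a + \<zeta> *s b))"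
  unfolding subharmonic_def
proof (intro conjI allI impI potential_less_top)
  have line: "continuous_on UNIV (\<lambda>\<zeta>. a + \<zeta> *s b)"
    by (intro continuous_on_vec_lambda[THEN continuous_on_eq, of _ "\<lambda>i \<zeta>. a $ i + \<zeta> * b $ i"] continuous_intros) (auto simp: vec_eq_iff)
  show "usc (\<lambda>\<zeta>. potential (a + \<zeta> *s b))"
    unfolding usc_def
  proof
    fix c
    have "open ((\<lambda>\<zeta>. a + \<zeta> *s b) -` {x. potential x < c})"
      using usc_potential by (intro open_vimage line) (auto simp: usc_def)
    then show "open {\<zeta>. potential (a + \<zeta> *s b) < c}" by (simp add: vimage_def)
  qed
  fix z :: complex and r :: real
  assume r: "0 < r"
  have contH: "continuous_on UNIV (\<lambda>\<zeta>. H (a + \<zeta> *s b))"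
    by (rule continuous_on_compose2[OF continuous_H line]) auto
  have "bounded ((\<lambda>\<zeta>. H (a + \<zeta> *s b)) ` cball z r)"
    by (intro compact_imp_bounded compact_continuous_image continuous_on_subset[OF contH]) auto
  then obtain B where "0 < B" and B: "\<And>\<zeta>. \<zeta> \<in> cball z r \<Longrightarrow> H (a + \<zeta> *s b) \<le> B"
    unfolding bounded_pos by (auto simp: abs_le_iff)
  have Bc: "H (a + z *s b) \<le> B" using B[of z] r by simp
  have Bs: "H (a + (z + of_real r * cis \<theta>) *s b) \<le> B" for \<theta>
    using B[of "z + of_real r * cis \<theta>"] r by (simp add: dist_norm norm_mult)
  define G where "G \<theta> = gap_sum B (a + (z + of_real r * cis \<theta>) *s b)" for \<theta>
  have meas: "(\<lambda>\<theta>. ennreal (w j) * log_gap (d j * B) (P j (a + (z + of_real r * cis \<theta>) *s b))) \<in> borel_measurable borel" for j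
    by (intro borel_measurable_continuous_onI continuous_on_compose2[OF continuous_gap] continuous_on_compose2[OF line] continuous_intros) auto
  have "ereal (total_weight * B) - enn2ereal (gap_sum B (a + z *s b))
      \<le> angular_mean (\<lambda>\<theta>. ereal (total_weight * B) - enn2ereal (G \<theta>))"
  proof (rule angular_mean_ge)
    show "G \<in> borel_measurable borel"
      unfolding G_def gap_sum_def by (intro borel_measurable_suminf_order meas)
    show "0 \<le> total_weight * B" using total_weight_nonneg \<open>0 < B\<close> by simp
    have single: "(\<integral>\<^sup>+\<theta>\<in>{0..2 * pi}. log_gap (d j * B) (P j (a + (z + of_real r * cis \<theta>) *s b)) \<partial>lborel)
        \<le> ennreal (2 * pi) * log_gap (d j * B) (P j (a + z *s b))" for j
    proof -
      obtain h where h: "\<And>\<zeta>. P j (a + \<zeta> *s b) = poly h \<zeta>" using poly_on_lines by blast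
      show ?thesis
        unfolding h by (intro nn_integral_log_gap_poly r) (use P_le_mono[OF Bc, of j] P_le_mono[OF Bs, of j] in \<open>simp_all only: h\<close>)
    qed
    have "(\<integral>\<^sup>+\<theta>\<in>{0..2 * pi}. G \<theta> \<partial>lborel)
      = (\<integral>\<^sup>+\<theta>. (\<Sum>j. ennreal (w j) * log_gap (d j * B) (P j (a + (z + of_real r * cis \<theta>) *s b)) * indicator {0..2 * pi} \<theta>) \<partial>lborel)"
      by (simp add: G_def gap_sum_def)
    also have "\<dots> = (\<Sum>j. \<integral>\<^sup>+\<theta>. ennreal (w j) * log_gap (d j * B) (P j (a + (z + of_real r * cis \<theta>) *s b)) * indicator {0..2 * pi} \<theta> \<partial>lborel)"
      using meas by (intro nn_integral_suminf) simp
    also have "\<dots> \<le> (\<Sum>j. ennreal (w j) * (ennreal (2 * pi) * log_gap (d j * B) (P j (a + z *s b))))"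
    proof (intro suminf_le summableI)
      fix j
      have "(\<integral>\<^sup>+\<theta>. ennreal (w j) * log_gap (d j * B) (P j (a + (z + of_real r * cis \<theta>) *s b)) * indicator {0..2 * pi} \<theta> \<partial>lborel)
        = ennreal (w j) * (\<integral>\<^sup>+\<theta>\<in>{0..2 * pi}. log_gap (d j * B) (P j (a + (z + of_real r * cis \<theta>) *s b)) \<partial>lborel)"
        unfolding mult.assoc
        by (intro nn_integral_cmult borel_measurable_log_gap_indicator continuous_on_compose2[OF continuous_P] continuous_on_compose2[OF line] continuous_intros) auto
      also have "\<dots> \<le> ennreal (w j) * (ennreal (2 * pi) * log_gap (d j * B) (P j (a + z *s b)))"
        by (intro mult_left_mono single) simp
      finally show "(\<integral>\<^sup>+\<theta>. ennreal (w j) * log_gap (d j * B) (P j (a + (z + of_real r * cis \<theta>) *s b)) * indicator {0..2 * pi} \<theta> \<partial>lborel)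
        \<le> ennreal (w j) * (ennreal (2 * pi) * log_gap (d j * B) (P j (a + z *s b)))" .
    qed
    also have "\<dots> = ennreal (2 * pi) * gap_sum B (a + z *s b)"
      unfolding gap_sum_def ennreal_suminf_cmult[symmetric] by (simp only: mult.left_commute)
    finally show "(\<integral>\<^sup>+\<theta>\<in>{0..2 * pi}. G \<theta> \<partial>lborel) \<le> ennreal (2 * pi) * gap_sum B (a + z *s b)" .
  qed
  then show "potential (a + z *s b) \<le> angular_mean (\<lambda>\<theta>. potential (a + (z + of_real r * cis \<theta>) *s b))"
    by (simp only: potential_eq[OF Bc] potential_eq[OF Bs] G_def)
qed

lemma plurisubharmonic_potential: "plurisubharmonic potential"
  unfolding plurisubharmonic_def using potential_less_top usc_potential subharmonic_potential_line by blast

end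

section \<open>A criterion for pluripolarity\<close>

definition eval2 :: "nat \<Rightarrow> (nat \<Rightarrow> nat \<Rightarrow> complex) \<Rightarrow> complex \<Rightarrow> complex \<Rightarrow> complex" where
  "eval2 n p z w = (\<Sum>a\<le>n. \<Sum>b\<le>n. p a b * z ^ a * w ^ b)"

section \<open>Cauchy estimates and polynomials with a coefficient of modulus 1\<close>

lemma norm_coeff_le_sup_circle:
  fixes q :: "complex poly"
  assumes r: "0 < r" and le: "\<And>z. cmod z = r \<Longrightarrow> cmod (poly q z) \<le> M"
  shows "cmod (coeff q k) \<le> M / r ^ k"
proof -
  have deriv_poly: "deriv (poly p) = poly (pderiv p)" for p :: "complex poly"
    by (intro ext DERIV_imp_deriv poly_DERIV)
  have "cmod ((deriv ^^ k) (poly q) 0) \<le> fact k * M / r ^ k"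
    by (rule Cauchy_inequality[OF _ _ r]) (auto intro!: holomorphic_intros continuous_intros le)
  moreover have "(deriv ^^ k) (poly q) = poly ((pderiv ^^ k) q)"
    by (induction k) (simp_all add: deriv_poly)
  moreover have "poly ((pderiv ^^ k) q) 0 = fact k * coeff q k"
    by (simp add: poly_0_coeff_0 coeff_higher_pderiv pochhammer_fact)
  ultimately have "fact k * cmod (coeff q k) \<le> fact k * (M / r ^ k)"
    by (simp add: norm_mult)
  then show ?thesis by (rule mult_left_le_imp_le) simp
qed

text \<open>Cauchy bounds the Taylor coefficients at c by M / r^i. Resumming on the unit circle,
  where |z - c| \<le> 1 + |c|, and applying Cauchy again there gives the claim. As
  \<open>r \<le> 1\<close>, the worst case is M / r^n; the n + 1 terms cost the factor 2^n.\<close>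

lemma norm_coeff_le_sup_disc:
  fixes q :: "complex poly"
  assumes r: "0 < r" "r \<le> 1" and le: "\<And>z. cmod (z - c) \<le> r \<Longrightarrow> cmod (poly q z) \<le> M" and deg: "degree q \<le> n"
  shows "cmod (coeff q k) \<le> M * (2 * (1 + cmod c) / r) ^ n"
proof -
  have M: "0 \<le> M" using le[of c] r by (smt (verit) norm_ge_zero diff_self norm_zero)
  define q' where "q' = q \<circ>\<^sub>p [:c, 1:]"
  have q': "poly q' t = poly q (c + t)" for t by (simp add: q'_def poly_pcompose algebra_simps)
  have deg': "degree q' \<le> n" using deg by (simp add: q'_def degree_pcompose)
  have coeff': "cmod (coeff q' i) \<le> M / r ^ i" for i
    by (rule norm_coeff_le_sup_circle) (use r le in \<open>auto simp: q'\<close>)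
  have sup: "cmod (poly q z) \<le> M * (2 * (1 + cmod c) / r) ^ n" if z: "cmod z = 1" for z
  proof -
    have "poly q z = poly q' (z - c)" by (simp add: q')
    also have "\<dots> = (\<Sum>i\<le>n. coeff q' i * (z - c) ^ i)"
      by (subst poly_as_sum_of_monoms'[OF deg', symmetric]) (simp add: poly_sum poly_monom)
    also have "cmod \<dots> \<le> (\<Sum>i\<le>n. M / r ^ n * (1 + cmod c) ^ n)"
    proof (rule order.trans[OF norm_sum], rule sum_mono)
      fix i assume i: "i \<in> {..n}"
      have "cmod (z - c) ^ i \<le> (1 + cmod c) ^ i"
        using norm_triangle_ineq4[of z c] z by (intro power_mono) auto
      also have "\<dots> \<le> (1 + cmod c) ^ n" using i by (intro power_increasing) auto
      finally have 1: "cmod (z - c) ^ i \<le> (1 + cmod c) ^ n" .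
      have "M / r ^ i \<le> M / r ^ n"
        using i r M by (intro divide_left_mono power_decreasing) auto
      then show "cmod (coeff q' i * (z - c) ^ i) \<le> M / r ^ n * (1 + cmod c) ^ n"
        unfolding norm_mult norm_power using coeff'[of i] 1 M r by (intro mult_mono) auto
    qed
    also have "\<dots> = real (n + 1) * (M / r ^ n * (1 + cmod c) ^ n)" by simp
    also have "\<dots> \<le> 2 ^ n * (M / r ^ n * (1 + cmod c) ^ n)"
    proof (intro mult_right_mono)
      have "n + 1 \<le> 2 ^ n" by (induction n) auto
      then show "real (n + 1) \<le> 2 ^ n" by (metis of_nat_le_iff of_nat_numeral of_nat_power)
    qed (use M r in auto)
    also have "\<dots> = M * (2 * (1 + cmod c) / r) ^ n"
      by (simp only: power_divide power_mult_distrib) simp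
    finally show ?thesis .
  qed
  show ?thesis using norm_coeff_le_sup_circle[of 1 q _ k, OF _ sup] by simp
qed

lemma sum_monom_degree: "degree (\<Sum>a\<le>n. monom (f a :: complex) a) \<le> n"
  by (intro degree_sum_le) (auto intro: order.trans[OF degree_monom_le])

lemma coeff_sum_monom: "k \<le> n \<Longrightarrow> coeff (\<Sum>a\<le>n. monom (f a :: complex) a) k = f k"
  by (simp add: coeff_sum if_distrib cong: if_cong)

text \<open>The one-variable estimate is used twice: in w for fixed z it bounds the coefficient of
  w^b, which is itself a polynomial in z; then in z.\<close>

lemma eval2_coeff_le_sup:
  assumes r: "0 < r" "r \<le> 1"
    and le: "\<And>z w. cmod (z - c) \<le> r \<Longrightarrow> cmod (w - c') \<le> r \<Longrightarrow> cmod (eval2 n p z w) \<le> M"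
    and ab: "a \<le> n" "b \<le> n"
  shows "cmod (p a b) \<le> M * (2 * (1 + cmod c) / r * (2 * (1 + cmod c') / r)) ^ n"
proof -
  define q where "q z = (\<Sum>b\<le>n. monom (\<Sum>a\<le>n. p a b * z ^ a) b)" for z
  have q: "poly (q z) w = eval2 n p z w" for z w
    unfolding q_def eval2_def poly_sum poly_monom sum_distrib_right by (rule sum.swap)
  define s where "s = (\<Sum>a\<le>n. monom (p a b) a)"
  have s: "poly s z = coeff (q z) b" for z
    using ab by (simp add: s_def q_def coeff_sum_monom poly_sum poly_monom)
  have "cmod (poly s z) \<le> M * (2 * (1 + cmod c') / r) ^ n" if z: "cmod (z - c) \<le> r" for z
    unfolding s by (rule norm_coeff_le_sup_disc[OF r]) (use z le in \<open>auto simp: q q_def[symmetric] intro: sum_monom_degree[of _ n, folded q_def]\<close>, simp add: q_def sum_monom_degree)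
  then have "cmod (coeff s a) \<le> M * (2 * (1 + cmod c') / r) ^ n * (2 * (1 + cmod c) / r) ^ n"
    by (rule norm_coeff_le_sup_disc[OF r]) (simp_all add: s_def sum_monom_degree)
  then show ?thesis
    using ab by (simp only: s_def coeff_sum_monom power_mult_distrib mult_ac)
qed

text \<open>The 2 in the exponent pays for the (n + 1)^2 terms, as n + 1 \<le> exp n. The factor
  beside n later becomes the majorant \<open>H\<close>.\<close>

lemma norm_eval2_le:
  assumes p: "\<And>a b. cmod (p a b) \<le> 1"
  shows "cmod (eval2 n p z w) \<le> exp (real n * (2 + cmod z + cmod w))"
proof -
  have pow: "x ^ a \<le> exp (real n * x)" if "0 \<le> x" "a \<le> n" for x :: real and a
  proof -
    have "x ^ a \<le> (exp x) ^ a" using that exp_ge_add_one_self[of x] by (intro power_mono) linarith+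
    also have "\<dots> \<le> (exp x) ^ n" using that by (intro power_increasing) auto
    also have "\<dots> = exp (real n * x)" by (simp add: exp_of_nat_mult)
    finally show ?thesis .
  qed
  have "cmod (eval2 n p z w) \<le> (\<Sum>a\<le>n. \<Sum>b\<le>n. 1 * exp (real n * cmod z) * exp (real n * cmod w))"
    unfolding eval2_def
    by (intro order.trans[OF norm_sum] sum_mono)
      (unfold norm_mult norm_power, intro mult_mono p pow, auto)
  also have "\<dots> = (1 + real n) * (1 + real n) * exp (real n * cmod z) * exp (real n * cmod w)"
    by simp
  also have "\<dots> \<le> exp (real n) * exp (real n) * exp (real n * cmod z) * exp (real n * cmod w)"
    by (intro mult_right_mono mult_mono exp_ge_add_one_self) auto
  also have "\<dots> = exp (real n * (2 + cmod z + cmod w))"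
    by (simp add: algebra_simps flip: exp_add)
  finally show ?thesis .
qed

lemma continuous_on_eval2:
  "continuous_on UNIV (\<lambda>x::complex ^ 2. eval2 n p (x $ 1) (x $ 2))"
  unfolding eval2_def by (intro continuous_intros)

lemma eval2_on_line:
  "\<exists>h. \<forall>\<zeta>. eval2 n p ((a + \<zeta> *s b) $ 1) ((a + \<zeta> *s b) $ 2) = poly h \<zeta>"
  by (rule exI[of _ "\<Sum>i\<le>n. \<Sum>j\<le>n. smult (p i j) ([:a $ 1, b $ 1:] ^ i * [:a $ 2, b $ 2:] ^ j)"])
    (simp add: eval2_def poly_sum mult.assoc)

text \<open>If |P| \<le> M on a polydisc inside the ball, all coefficients are at most M D^n with D
  depending on the polydisc only, so a coefficient of modulus 1 forbids M below D^(-n). The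
  uniformity of C in n and p is the point: the ball can be fixed before the polynomial.\<close>

lemma eval2_large_in_ball:
  fixes x :: "complex ^ 2"
  assumes e: "0 < e"
  shows "\<exists>C\<ge>0. \<forall>n p. n \<ge> 1 \<longrightarrow> (\<exists>a\<le>n. \<exists>b\<le>n. cmod (p a b) = 1) \<longrightarrow>
    (\<exists>y\<in>ball x e. cmod (eval2 n p (y $ 1) (y $ 2)) > exp (- C * real n))"
proof -
  \<comment> \<open>The polydisc of radius r fits into the ball, because the norm is at most the sum
    of the two coordinate moduli.\<close>
  define r where "r = min 1 (e / 3)"
  have r: "0 < r" "r \<le> 1" "2 * r < e" using e by (auto simp: r_def)
  define D where "D = 2 * (1 + cmod (x $ 1)) / r * (2 * (1 + cmod (x $ 2)) / r)"
  have 1: "1 \<le> 2 * (1 + t) / r" if "0 \<le> t" for t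
    using r that by (simp add: le_divide_eq)
  have D: "1 * 1 \<le> D" unfolding D_def by (intro mult_mono 1) (use r in auto)
  show ?thesis
  \<comment> \<open>With \<open>ln D\<close> alone only 1 \<le> 1 would result; the extra 1 gives
    the contradiction 1 \<le> exp (- n), as \<open>n \<ge> 1\<close>.\<close>
  proof (intro exI[of _ "ln D + 1"] conjI allI impI)
    show "0 \<le> ln D + 1" using D by simp
    fix n :: nat and p :: "nat \<Rightarrow> nat \<Rightarrow> complex"
    assume n: "1 \<le> n" and "\<exists>a\<le>n. \<exists>b\<le>n. cmod (p a b) = 1"
    then obtain a b where ab: "a \<le> n" "b \<le> n" "cmod (p a b) = 1" by blast
    define M where "M = exp (- (ln D + 1) * real n)"
    show "\<exists>y\<in>ball x e. exp (- (ln D + 1) * real n) < cmod (eval2 n p (y $ 1) (y $ 2))"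
    proof (rule ccontr)
      assume "\<not> ?thesis"
      then have neg: "\<And>y. y \<in> ball x e \<Longrightarrow> cmod (eval2 n p (y $ 1) (y $ 2)) \<le> M"
        unfolding M_def by (meson linorder_not_less)
      have "cmod (eval2 n p z w) \<le> M" if "cmod (z - x $ 1) \<le> r" "cmod (w - x $ 2) \<le> r" for z w
      proof -
        define y :: "complex ^ 2" where "y = vector [z, w]"
        have y: "y $ 1 = z" "y $ 2 = w" by (simp_all add: y_def)
        have "dist x y = norm (y - x)" by (simp add: dist_norm norm_minus_commute)
        also have "\<dots> \<le> cmod ((y - x) $ 1) + cmod ((y - x) $ 2)"
          unfolding norm_vec_def by (rule order.trans[OF L2_set_le_sum]) (auto simp: sum_2)
        also have "\<dots> < e" using that r(3) by (simp add: y)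
        finally show ?thesis using neg[of y] by (simp add: y)
      qed
      from eval2_coeff_le_sup[OF r(1,2) this ab(1,2)] have "1 \<le> M * D ^ n"
        by (simp add: ab(3) D_def)
      also have "D ^ n = exp (ln D * real n)"
        using D by (simp add: exp_of_nat2_mult)
      also have "M * exp (ln D * real n) = exp (- real n)"
        by (simp add: M_def algebra_simps flip: exp_add)
      finally show False using n by simp
    qed
  qed
qed

text \<open>
  The potential is a weighted sum of \<open>(1/n) * ln \<bar>P\<bar>\<close> over a sequence of the given polynomials.
  Both the weights and the polynomials are chosen along a nested sequence of closed balls on which
  the logarithms are bounded below, so that the sum is finite at the common point of the balls.
\<close>

theorem pluripolar_if_small_polynomials:
  fixes K :: "(complex ^ 2) set"
  assumes small: "\<And>A. \<exists>n\<ge>1. \<exists>p. (\<forall>a b. cmod (p a b) \<le> 1) \<and> (\<exists>a\<le>n. \<exists>b\<le>n. cmod (p a b) = 1) \<and>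
    (\<forall>x\<in>K. cmod (eval2 n p (x $ 1) (x $ 2)) \<le> exp (- A * real n))"
  shows "pluripolar K"
proof -
  \<comment> \<open>The k-th summand will get the weight \<eta> / n. The bound on K then makes it at
    most -1 there, while \<open>low\<close> makes it at least - (1/2)^k on the ball: the sum
    diverges on K and converges at a common point of the balls.\<close>
  define good where "good k n p \<eta> \<longleftrightarrow> 1 \<le> n \<and> (\<forall>a b. cmod (p a b) \<le> 1) \<and> 0 < \<eta> \<and> \<eta> \<le> (1/2) ^ k \<and>
    (\<forall>x\<in>K. cmod (eval2 n p (x $ 1) (x $ 2)) \<le> exp (- (1 / \<eta>) * real n))"
    for k :: nat and n p and \<eta> :: real
  define low where "low k n p \<eta> x e \<longleftrightarrow> (\<forall>y\<in>cball x e. cmod (eval2 n p (y $ 1) (y $ 2)) \<ge> exp (- ((1/2) ^ k / \<eta>) * real n))"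
    for k :: nat and n p and \<eta> e :: real and x :: "complex ^ 2"
  have step: "\<exists>n p \<eta> x' e'. good k n p \<eta> \<and> low k n p \<eta> x' e' \<and> 0 < e' \<and> cball x' e' \<subseteq> cball x e"
    if e: "0 < e" for x :: "complex ^ 2" and e :: real and k
  proof -
    obtain C where C: "0 \<le> C" and
      large: "\<And>n p. n \<ge> 1 \<Longrightarrow> (\<exists>a\<le>n. \<exists>b\<le>n. cmod (p a b) = 1) \<Longrightarrow>
        (\<exists>y\<in>ball x e. cmod (eval2 n p (y $ 1) (y $ 2)) > exp (- C * real n))"
      using eval2_large_in_ball[OF e, of x] by blast
    \<comment> \<open>The order of choices matters: the ball gives C, then C gives \<eta>, and only
      then is a polynomial with smallness 1 / \<eta> picked. Here (1/2)^k / \<eta> = C + 1 exceeds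
      C; the added 1 also ensures \<eta> \<le> (1/2)^k and a nonzero denominator.\<close>
    define \<eta> where "\<eta> = (1/2) ^ k / (C + 1)"
    have \<eta>: "0 < \<eta>" "\<eta> \<le> (1/2) ^ k" using C by (auto simp: \<eta>_def divide_le_eq mult_le_cancel_left1)
    have \<eta>C: "C \<le> (1/2) ^ k / \<eta>" using C by (simp add: \<eta>_def)
    obtain n p where np: "n \<ge> 1" "\<forall>a b. cmod (p a b) \<le> 1" "\<exists>a\<le>n. \<exists>b\<le>n. cmod (p a b) = 1"
      "\<forall>x\<in>K. cmod (eval2 n p (x $ 1) (x $ 2)) \<le> exp (- (1 / \<eta>) * real n)"
      using small[of "1 / \<eta>"] by blast
    obtain y :: "complex ^ 2" where y: "y \<in> ball x e" "cmod (eval2 n p (y $ 1) (y $ 2)) > exp (- C * real n)"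
      using large[OF np(1,3)] by blast
    define U where "U = ball x e \<inter> {y. exp (- C * real n) < cmod (eval2 n p (y $ 1) (y $ 2))}"
    have "open U"
      unfolding U_def by (intro open_Int open_ball open_Collect_less continuous_intros continuous_on_eval2)
    moreover have "y \<in> U" using y by (simp add: U_def)
    ultimately obtain e' where e': "0 < e'" "cball y e' \<subseteq> U" by (meson open_contains_cball)
    have "low k n p \<eta> y e'"
      unfolding low_def
    proof
      fix t assume "t \<in> cball y e'"
      then have "t \<in> U" using e' by blast
      then have "exp (- C * real n) \<le> cmod (eval2 n p (t $ 1) (t $ 2))" by (simp add: U_def)
      moreover have "- ((1/2) ^ k / \<eta>) * real n \<le> - C * real n"
        using \<eta>C by (intro mult_right_mono) auto
      ultimately show "exp (- ((1/2) ^ k / \<eta>) * real n) \<le> cmod (eval2 n p (t $ 1) (t $ 2))"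
        by (meson exp_le_cancel_iff order.trans)
    qed
    moreover have "cball y e' \<subseteq> cball x e" using e'(2) by (auto simp: U_def)
    ultimately show ?thesis using np \<eta> e'(1) unfolding good_def by blast
  qed
  define Q where "Q k s \<longleftrightarrow> (case s of (n, p, \<eta>, x, e) \<Rightarrow> good k n p \<eta> \<and> low k n p \<eta> x e \<and> 0 < e)"
    for k and s :: "nat \<times> (nat \<Rightarrow> nat \<Rightarrow> complex) \<times> real \<times> (complex ^ 2) \<times> real"
  define R where "R s s' \<longleftrightarrow> (case (s, s') of ((n, p, \<eta>, x, e), (n', p', \<eta>', x', e')) \<Rightarrow> cball x' e' \<subseteq> cball x e)"
    for s s' :: "nat \<times> (nat \<Rightarrow> nat \<Rightarrow> complex) \<times> real \<times> (complex ^ 2) \<times> real"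
  have "\<exists>f. \<forall>k. Q k (f k) \<and> R (f k) (f (Suc k))"
  proof (rule dependent_nat_choice)
    obtain n p \<eta> x e where "good 0 n p \<eta>" "low 0 n p \<eta> x e" "0 < e"
      using step[of 1 0 0] by auto
    then show "\<exists>s. Q 0 s" by (intro exI[of _ "(n, p, \<eta>, x, e)"]) (simp add: Q_def)
    fix s k assume "Q k s"
    then show "\<exists>s'. Q (Suc k) s' \<and> R s s'"
      using step[of "snd (snd (snd (snd s)))" "Suc k" "fst (snd (snd (snd s)))"]
      by (cases s) (auto simp: Q_def R_def)
  qed
  then obtain f where f: "\<And>k. Q k (f k)" "\<And>k. R (f k) (f (Suc k))" by blast
  define n p \<eta> c e where "n k = fst (f k)" and "p k = fst (snd (f k))" and "\<eta> k = fst (snd (snd (f k)))"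
    and "c k = fst (snd (snd (snd (f k))))" and "e k = snd (snd (snd (snd (f k))))" for k
  have Q: "good k (n k) (p k) (\<eta> k)" "low k (n k) (p k) (\<eta> k) (c k) (e k)" "0 < e k" for k
    using f(1)[of k] by (auto simp: Q_def n_def p_def \<eta>_def c_def e_def split: prod.splits)
  have R: "cball (c (Suc k)) (e (Suc k)) \<subseteq> cball (c k) (e k)" for k
    using f(2)[of k] by (auto simp: R_def c_def e_def split: prod.splits)
  have n1: "1 \<le> n k" and p1: "cmod (p k a b) \<le> 1" and \<eta>0: "0 < \<eta> k" and \<eta>1: "\<eta> k \<le> (1/2) ^ k" for k a b
    using Q(1)[of k] by (auto simp: good_def)
  have "\<Inter> (range (\<lambda>k. cball (c k) (e k))) \<noteq> {}"
  proof (rule compact_nest)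
    show "cball (c k) (e k) \<noteq> {}" for k using Q(3)[of k] by simp
    show "cball (c m) (e m) \<subseteq> cball (c k) (e k)" if "k \<le> m" for k m
      using lift_Suc_antimono_le[of "\<lambda>k. cball (c k) (e k)", OF R that] .
  qed simp
  then obtain x0 where "x0 \<in> \<Inter> (range (\<lambda>k. cball (c k) (e k)))" by blast
  then have x0: "x0 \<in> cball (c k) (e k)" for k by blast

  define P where "P k x = eval2 (n k) (p k) (x $ 1) (x $ 2)" for k and x :: "complex ^ 2"
  define w where "w k = \<eta> k / real (n k)" for k
  define H where "H x = 2 + cmod (x $ 1) + cmod (x $ 2)" for x :: "complex ^ 2"
  have wn: "w k * real (n k) = \<eta> k" for k using n1[of k] by (simp add: w_def)
  have w0: "0 \<le> w k" for k using \<eta>0[of k] by (simp add: w_def)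
  have sum_half: "summable (\<lambda>k. (1/2 :: real) ^ k)" by (simp add: summable_geometric)
  interpret log_series w "\<lambda>k. real (n k)" P H
  proof
    show "summable (\<lambda>k. w k * real (n k))"
      unfolding wn by (rule summable_comparison_test'[OF sum_half, of 0]) (use \<eta>0 \<eta>1 in \<open>auto simp: less_imp_le\<close>)
    show "continuous_on UNIV (P k)" for k
      unfolding P_def by (rule continuous_on_eval2)
    show "continuous_on UNIV H"
      unfolding H_def by (intro continuous_intros)
    show "cmod (P k x) \<le> exp (real (n k) * H x)" for k x
      unfolding P_def H_def by (intro norm_eval2_le p1)
    show "\<exists>h. \<forall>\<zeta>. P k (a + \<zeta> *s b) = poly h \<zeta>" for k a b
      unfolding P_def by (rule eval2_on_line)
  qed (auto simp: w0 H_def)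
  have nz: "potential x0 \<noteq> - \<infinity>"
  proof -
    have "ennreal (w k) * log_gap (real (n k) * H x0) (P k x0) \<le> ennreal ((1/2) ^ k * (H x0 + 1))" for k
    proof -
      have low: "exp (- ((1/2) ^ k / \<eta> k) * real (n k)) \<le> cmod (P k x0)"
        using Q(2)[of k] x0[of k] unfolding low_def P_def by blast
      have P0: "P k x0 \<noteq> 0" using low by (auto simp: not_le)
      have "- ((1/2) ^ k / \<eta> k) * real (n k) \<le> ln (cmod (P k x0))"
        using low P0 by (simp add: ln_ge_iff)
      then have "w k * (real (n k) * H x0 - ln (cmod (P k x0))) \<le> w k * (real (n k) * H x0 + (1/2) ^ k / \<eta> k * real (n k))"
        by (intro mult_left_mono w0) simp
      also have "\<dots> = \<eta> k * H x0 + (1/2) ^ k"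
        using n1[of k] \<eta>0[of k] by (simp add: w_def field_simps)
      also have "\<dots> \<le> (1/2) ^ k * H x0 + (1/2) ^ k"
        using \<eta>1[of k] H_nonneg[of x0] by (intro add_right_mono mult_right_mono)
      also have "\<dots> = (1/2) ^ k * (H x0 + 1)" by (simp add: distrib_left)
      finally have "ennreal (w k * (real (n k) * H x0 - ln (cmod (P k x0)))) \<le> ennreal ((1/2) ^ k * (H x0 + 1))"
        by (rule ennreal_leI)
      then show ?thesis using P0 w0 by (simp add: log_gap_def ennreal_mult')
    qed
    then have "gap_sum (H x0) x0 \<le> (\<Sum>k. ennreal ((1/2) ^ k * (H x0 + 1)))"
      unfolding gap_sum_def by (intro suminf_le summableI)
    also have "\<dots> < top"
      unfolding less_top[symmetric] using H_nonneg[of x0]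
      by (intro ennreal_suminf_neq_top summable_mult2 sum_half) auto
    finally show ?thesis by (cases "gap_sum (H x0) x0") (auto simp: potential_def)
  qed
  have inf: "potential x = - \<infinity>" if x: "x \<in> K" for x
  proof -
    have "ennreal 1 \<le> ennreal (w k) * log_gap (real (n k) * H x) (P k x)" for k
    proof (cases "P k x = 0")
      case True
      then show ?thesis using \<eta>0[of k] n1[of k] by (simp add: w_def ennreal_mult_top)
    next
      case False
      have "cmod (P k x) \<le> exp (- (1 / \<eta> k) * real (n k))"
        using Q(1)[of k] x unfolding good_def P_def by blast
      then have "ln (cmod (P k x)) \<le> - (1 / \<eta> k) * real (n k)" by (rule ln_le_of_le_exp[OF False])
      moreover have "0 \<le> real (n k) * H x" using H_nonneg[of x] by simp
      ultimately have "w k * ((1 / \<eta> k) * real (n k)) \<le> w k * (real (n k) * H x - ln (cmod (P k x)))"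
        by (intro mult_left_mono w0) simp
      moreover have "w k * ((1 / \<eta> k) * real (n k)) = 1"
        using \<eta>0[of k] n1[of k] by (simp add: w_def)
      ultimately have "1 \<le> w k * (real (n k) * H x - ln (cmod (P k x)))" by metis
      then have "ennreal 1 \<le> ennreal (w k * (real (n k) * H x - ln (cmod (P k x))))"
        by (rule ennreal_leI)
      then show ?thesis using False w0[of k] by (simp add: log_gap_def ennreal_mult')
    qed
    then have "(\<Sum>k::nat. ennreal 1) \<le> gap_sum (H x) x"
      unfolding gap_sum_def by (intro suminf_le summableI)
    moreover have "(\<Sum>k::nat. ennreal 1) = top"
      using summable_suminf_not_top[of "\<lambda>_::nat. 1::real"] summable_const_iff[of "1::real"] by auto
    ultimately have "gap_sum (H x) x = top" by (simp add: top_unique)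
    then show ?thesis by (simp add: potential_def)
  qed
  show ?thesis
    unfolding pluripolar_def using plurisubharmonic_potential nz inf by blast
qed

section \<open>Fourier coefficients\<close>

definition annihilates_circle :: "(complex \<Rightarrow> complex) \<Rightarrow> bool" where
  "annihilates_circle G \<longleftrightarrow> continuous_on (sphere 0 1) G \<and>
     (\<forall>k::int. ((\<lambda>t. G (cis t) * cis (of_int k * t)) has_integral 0) {0..2 * pi})"

lemma annihilates_circle_add:
  assumes "annihilates_circle G" "annihilates_circle G'"
  shows "annihilates_circle (\<lambda>z. G z + G' z)"
  unfolding annihilates_circle_def
proof (intro conjI allI)
  fix k :: int
  have "((\<lambda>t. G (cis t) * cis (of_int k * t) + G' (cis t) * cis (of_int k * t)) has_integral 0 + 0) {0..2 * pi}"
    using assms by (intro has_integral_add) (auto simp: annihilates_circle_def)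
  then show "((\<lambda>t. (G (cis t) + G' (cis t)) * cis (of_int k * t)) has_integral 0) {0..2 * pi}"
    by (simp add: distrib_right)
qed (use assms in \<open>auto simp: annihilates_circle_def intro!: continuous_intros\<close>)

text \<open>Multiplication by z or \<open>cnj z\<close> shifts the frequency by one, which preserves
  the vanishing of all coefficients.\<close>

lemma annihilates_circle_mult_linear:
  assumes "annihilates_circle G"
  shows "annihilates_circle (\<lambda>z. G z * (\<alpha> * z + \<beta> * cnj z))"
  unfolding annihilates_circle_def
proof (intro conjI allI)
  fix k :: int
  have "((\<lambda>t. \<alpha> * (G (cis t) * cis (of_int (k + 1) * t)) + \<beta> * (G (cis t) * cis (of_int (k - 1) * t))) has_integral \<alpha> * 0 + \<beta> * 0) {0..2 * pi}"
    using assms unfolding annihilates_circle_def by (intro has_integral_add has_integral_mult_right) blast+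
  moreover have "\<alpha> * (G (cis t) * cis (of_int (k + 1) * t)) + \<beta> * (G (cis t) * cis (of_int (k - 1) * t))
      = G (cis t) * (\<alpha> * cis t + \<beta> * cnj (cis t)) * cis (of_int k * t)" for t
  proof -
    have "cis (of_int (k + 1) * t) = cis t * cis (of_int k * t)"
      "cis (of_int (k - 1) * t) = cnj (cis t) * cis (of_int k * t)"
      by (simp_all add: cis_mult cis_cnj algebra_simps)
    then show ?thesis by (simp add: algebra_simps)
  qed
  ultimately show "((\<lambda>t. G (cis t) * (\<alpha> * cis t + \<beta> * cnj (cis t)) * cis (of_int k * t)) has_integral 0) {0..2 * pi}"
    by simp
qed (use assms in \<open>auto simp: annihilates_circle_def intro!: continuous_intros\<close>)

lemma annihilates_circle_mult_const:
  assumes "annihilates_circle G"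
  shows "annihilates_circle (\<lambda>z. G z * c)"
  unfolding annihilates_circle_def
proof (intro conjI allI)
  fix k :: int
  have "((\<lambda>t. c * (G (cis t) * cis (of_int k * t))) has_integral c * 0) {0..2 * pi}"
    using assms unfolding annihilates_circle_def by (intro has_integral_mult_right) blast+
  then show "((\<lambda>t. G (cis t) * c * cis (of_int k * t)) has_integral 0) {0..2 * pi}"
    by (simp add: mult_ac)
qed (use assms in \<open>auto simp: annihilates_circle_def intro!: continuous_intros\<close>)

lemma annihilates_circle_mult_real_polynomial:
  assumes "real_polynomial_function h" "annihilates_circle G"
  shows "annihilates_circle (\<lambda>z. G z * of_real (h z))"
  using assms
proof (induction h arbitrary: G)
  case (linear h)
  interpret bounded_linear h by fact
  \<comment> \<open>Every real-linear functional on the plane is \<alpha> z + \<beta> cnj z; the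
    values solve h 1 = \<alpha> + \<beta> and h i = i (\<alpha> - \<beta>).\<close>
  define \<alpha> \<beta> where "\<alpha> = (of_real (h 1) - \<i> * of_real (h \<i>)) / 2" and "\<beta> = (of_real (h 1) + \<i> * of_real (h \<i>)) / 2"
  have "of_real (h z) = \<alpha> * z + \<beta> * cnj z" for z
  proof -
    have "Re z *\<^sub>R 1 + Im z *\<^sub>R \<i> = z" by (simp add: complex_eq_iff)
    then have "h z = h (Re z *\<^sub>R 1 + Im z *\<^sub>R \<i>)" by simp
    also have "\<dots> = Re z * h 1 + Im z * h \<i>" by (simp only: add scaleR real_scaleR_def)
    finally show ?thesis by (simp add: \<alpha>_def \<beta>_def complex_eq_iff field_simps)
  qed
  then show ?case using annihilates_circle_mult_linear[OF linear.prems, of \<alpha> \<beta>] by simp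
next
  case (const c)
  then show ?case by (intro annihilates_circle_mult_const)
next
  case (add h h')
  have "annihilates_circle (\<lambda>z. G z * of_real (h z) + G z * of_real (h' z))"
    by (intro annihilates_circle_add add)
  then show ?case by (simp add: distrib_left)
next
  case (mult h h')
  have "annihilates_circle (\<lambda>z. (G z * of_real (h z)) * of_real (h' z))"
    by (intro mult)
  then show ?case by (simp add: mult_ac)
qed

text \<open>By Stone-Weierstrass \<open>cnj G\<close> is uniformly close to a polynomial function g,
  and G * g has integral 0. Hence the integral of |G|^2 is arbitrarily small, and continuity of G
  finishes the argument.\<close>

lemma annihilates_circle_imp_zero:
  assumes G: "annihilates_circle G" and z: "cmod z = 1"
  shows "G z = 0"
proof -
  have cont: "continuous_on (sphere 0 1) G" using G by (simp add: annihilates_circle_def)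
  have cont': "continuous_on {0..2 * pi} (\<lambda>t. G (cis t))"
    by (rule continuous_on_compose2[OF cont]) (auto intro!: continuous_intros)
  obtain M where M: "0 < M" "\<And>z. cmod z = 1 \<Longrightarrow> cmod (G z) \<le> M"
    using compact_imp_bounded[OF compact_continuous_image[OF cont]] unfolding bounded_pos by auto
  define I where "I = integral {0..2 * pi} (\<lambda>t. (cmod (G (cis t)))\<^sup>2)"
  have I: "((\<lambda>t. (cmod (G (cis t)))\<^sup>2) has_integral I) {0..2 * pi}"
    unfolding I_def by (intro integrable_integral integrable_continuous_real continuous_intros cont')
  have "\<bar>I\<bar> \<le> \<epsilon>" if "0 < \<epsilon>" for \<epsilon>
  proof -
    define \<delta> where "\<delta> = \<epsilon> / (M * (2 * pi))"
    have \<delta>: "0 < \<delta>" using that M by (simp add: \<delta>_def)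
    obtain g where g: "polynomial_function g" "\<And>z. cmod z = 1 \<Longrightarrow> cmod (cnj (G z) - g z) < \<delta>"
      using Stone_Weierstrass_polynomial_function[of "sphere 0 1" "\<lambda>z. cnj (G z)" \<delta>] cont \<delta>
      by (auto intro: continuous_intros)
    have Re: "real_polynomial_function (\<lambda>z. Re (g z))" and Im: "real_polynomial_function (\<lambda>z. Im (g z))"
      using g(1) bounded_linear_Re bounded_linear_Im by (auto simp: polynomial_function_def o_def)
    have "annihilates_circle (\<lambda>z. G z * of_real (Re (g z)) + G z * of_real (Im (g z)) * \<i>)"
      by (intro annihilates_circle_add annihilates_circle_mult_const annihilates_circle_mult_real_polynomial Re Im G)
    moreover have "G z * of_real (Re (g z)) + G z * of_real (Im (g z)) * \<i> = G z * g z" for z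
      by (simp add: complex_eq_iff algebra_simps)
    ultimately have "annihilates_circle (\<lambda>z. G z * g z)" by simp
    then have "((\<lambda>t. G (cis t) * g (cis t) * cis (of_int 0 * t)) has_integral 0) {0..2 * pi}"
      unfolding annihilates_circle_def by blast
    then have "((\<lambda>t. G (cis t) * g (cis t)) has_integral 0) {0..2 * pi}" by simp
    moreover have "((\<lambda>t. of_real ((cmod (G (cis t)))\<^sup>2)) has_integral (of_real I :: complex)) {0..2 * pi}"
      using I by (rule has_integral_of_real)
    ultimately have "((\<lambda>t. of_real ((cmod (G (cis t)))\<^sup>2) - G (cis t) * g (cis t)) has_integral (of_real I - 0)) {0..2 * pi}"
      by (intro has_integral_diff)
    moreover have "cmod (of_real ((cmod (G (cis t)))\<^sup>2) - G (cis t) * g (cis t)) \<le> M * \<delta>" for t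
    proof -
      have "of_real ((cmod (G (cis t)))\<^sup>2) - G (cis t) * g (cis t) = G (cis t) * (cnj (G (cis t)) - g (cis t))"
        by (subst complex_norm_square) (simp add: algebra_simps)
      also have "cmod \<dots> \<le> M * \<delta>"
        unfolding norm_mult using M(2)[of "cis t"] g(2)[of "cis t"] M(1) by (intro mult_mono) auto
      finally show ?thesis .
    qed
    ultimately have "cmod (of_real I - 0) \<le> M * \<delta> * measure lborel {0..2 * pi}"
      using M \<delta> by (intro has_integral_bound_real[where B = "M * \<delta>" and S = "{}"]) (auto simp: less_imp_le)
    also have "\<dots> = \<epsilon>" using M by (simp add: \<delta>_def)
    finally show ?thesis by simp
  qed
  then have "I = 0" by (metis abs_le_zero_iff dense_ge)
  then have zero: "\<forall>t\<in>{0..2 * pi}. (cmod (G (cis t)))\<^sup>2 = 0"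
    unfolding I_def by (subst (asm) integral_eq_0_iff) (auto intro!: continuous_intros cont')
  have "z = cis (Arg2pi z)" using z by (metis Arg2pi_eq cis_conv_exp mult_1 of_real_1)
  then show ?thesis using zero Arg2pi_ge_0[of z] Arg2pi_lt_2pi[of z] by (metis atLeastAtMost_iff less_imp_le norm_eq_zero zero_eq_power2)
qed

section \<open>Fourier coefficients of derivatives\<close>

definition fourier_coeff :: "(real \<Rightarrow> complex) \<Rightarrow> int \<Rightarrow> complex" where
  "fourier_coeff F k = integral {0..2 * pi} (\<lambda>t. F t * cis (- of_int k * t)) / of_real (2 * pi)"

lemma has_vector_derivative_cis_mult:
  "((\<lambda>t. cis (c * t)) has_vector_derivative \<i> * of_real c * cis (c * t)) (at t within T)"
proof -
  have "((\<lambda>t. exp (t *\<^sub>R (\<i> * of_real c))) has_vector_derivative exp (t *\<^sub>R (\<i> * of_real c)) * (\<i> * of_real c)) (at t within T)"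
    by (rule exp_scaleR_has_vector_derivative_right)
  then show ?thesis by (simp add: cis_conv_exp scaleR_conv_of_real mult_ac)
qed

lemma cis_2pi_int: "cis (of_int k * (2 * pi)) = 1"
  using cis_multiple_2pi[of "of_int k"] by (simp add: mult_ac)

lemma fourier_coeff_derivative:
  assumes F: "\<And>t. (F has_vector_derivative F' t) (at t)" and cont: "continuous_on {0..2 * pi} F'"
    and per: "F (2 * pi) = F 0"
  shows "fourier_coeff F' k = \<i> * of_int k * fourier_coeff F k"
proof -
  have contF: "continuous_on {0..2 * pi} F"
    using F by (intro continuous_at_imp_continuous_on ballI has_vector_derivative_continuous)
  let ?e = "\<lambda>t. cis (- of_int k * t)"
  have "((\<lambda>t. F t * (\<i> * of_real (- of_int k) * ?e t) + F' t * ?e t) has_integral (F (2 * pi) * ?e (2 * pi) - F 0 * ?e 0)) {0..2 * pi}"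
    by (intro fundamental_theorem_of_calculus has_vector_derivative_mult has_vector_derivative_cis_mult
        has_vector_derivative_at_within[OF F]) simp
  moreover have "?e (2 * pi) = 1" using cis_2pi_int[of "- k"] by simp
  ultimately have 1: "((\<lambda>t. F t * (\<i> * of_real (- of_int k) * ?e t) + F' t * ?e t) has_integral 0) {0..2 * pi}"
    using per by simp
  have 2: "((\<lambda>t. F t * ?e t) has_integral (integral {0..2 * pi} (\<lambda>t. F t * ?e t))) {0..2 * pi}"
    by (intro integrable_integral integrable_continuous_real continuous_intros contF)
  have "((\<lambda>t. (F t * (\<i> * of_real (- of_int k) * ?e t) + F' t * ?e t) + \<i> * of_int k * (F t * ?e t)) has_integral
      (0 + \<i> * of_int k * integral {0..2 * pi} (\<lambda>t. F t * ?e t))) {0..2 * pi}"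
    by (intro has_integral_add 1 has_integral_mult_right 2)
  then have "((\<lambda>t. F' t * ?e t) has_integral (\<i> * of_int k * integral {0..2 * pi} (\<lambda>t. F t * ?e t))) {0..2 * pi}"
    by (simp add: algebra_simps)
  then show ?thesis by (simp add: fourier_coeff_def integral_unique)
qed

text \<open>Cauchy-Schwarz in the form that the mean of |F| is at most its root mean square,
  obtained by integrating (|F| - m)^2 \<ge> 0 with m the mean of |F|.\<close>

lemma norm_fourier_coeff_le:
  assumes cont: "continuous_on {0..2 * pi} F"
  shows "cmod (fourier_coeff F k) \<le> sqrt (1 / (2 * pi) * integral {0..2 * pi} (\<lambda>t. (cmod (F t))\<^sup>2))"
proof -
  define J where "J = integral {0..2 * pi} (\<lambda>t. cmod (F t))"
  define m where "m = J / (2 * pi)"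
  define I where "I = integral {0..2 * pi} (\<lambda>t. (cmod (F t))\<^sup>2)"
  have J: "((\<lambda>t. cmod (F t)) has_integral J) {0..2 * pi}"
    unfolding J_def by (intro integrable_integral integrable_continuous_real continuous_intros cont)
  have I: "((\<lambda>t. (cmod (F t))\<^sup>2) has_integral I) {0..2 * pi}"
    unfolding I_def by (intro integrable_integral integrable_continuous_real continuous_intros cont)
  have "cmod (integral {0..2 * pi} (\<lambda>t. F t * cis (- of_int k * t))) \<le> J"
    unfolding J_def
    by (intro integral_norm_bound_integral integrable_continuous_real continuous_intros cont) (simp add: norm_mult)
  then have le: "cmod (fourier_coeff F k) \<le> m"
    by (simp add: fourier_coeff_def m_def norm_divide divide_right_mono)
  have const: "((\<lambda>t. m\<^sup>2) has_integral (2 * pi - 0) *\<^sub>R m\<^sup>2) {0..2 * pi}"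
    using has_integral_const_real[of "m\<^sup>2" 0 "2 * pi"] by simp
  have "((\<lambda>t. (cmod (F t))\<^sup>2 - 2 * m * cmod (F t) + m\<^sup>2) has_integral (I - 2 * m * J + (2 * pi - 0) *\<^sub>R m\<^sup>2)) {0..2 * pi}"
    by (intro has_integral_add has_integral_diff has_integral_mult_right I J const)
  moreover have "0 \<le> (cmod (F t))\<^sup>2 - 2 * m * cmod (F t) + m\<^sup>2" for t
    using zero_le_power2[of "cmod (F t) - m"] by (simp add: power2_diff mult_ac)
  ultimately have "0 \<le> I - 2 * m * J + (2 * pi - 0) *\<^sub>R m\<^sup>2"
    by (rule has_integral_nonneg)
  moreover have "J = 2 * pi * m" by (simp add: m_def)
  ultimately have "2 * pi * m\<^sup>2 \<le> I" by (simp add: power2_eq_square algebra_simps)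
  then have "m\<^sup>2 \<le> 1 / (2 * pi) * I" by (simp add: field_simps)
  then have "m \<le> sqrt (1 / (2 * pi) * I)" by (rule real_le_rsqrt)
  then show ?thesis using le by (simp add: I_def)
qed

lemma nth_vector_derivative_has_derivative:
  assumes "smooth_on_circle f"
  shows "(nth_vector_derivative j (circle_lift f) has_vector_derivative nth_vector_derivative (Suc j) (circle_lift f) t) (at t)"
  using assms by (simp add: smooth_on_circle_def nth_vector_derivative_def flip: vector_derivative_works)

text \<open>Removes the boundary terms when integrating by parts repeatedly. The induction step
  differentiates the periodicity relation and uses uniqueness of derivatives.\<close>

lemma nth_vector_derivative_periodic:
  assumes "smooth_on_circle f"
  shows "nth_vector_derivative j (circle_lift f) (t + 2 * pi) = nth_vector_derivative j (circle_lift f) t"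
proof (induction j arbitrary: t)
  case 0
  then show ?case by (simp add: nth_vector_derivative_def circle_lift_def cis.ctr)
next
  case (Suc j)
  let ?D = "nth_vector_derivative j (circle_lift f)"
  have "((\<lambda>t. t + 2 * pi) has_vector_derivative 1) (at t)"
    by (auto intro!: derivative_eq_intros)
  from vector_diff_chain_at[OF this nth_vector_derivative_has_derivative[OF assms]]
  have "((?D \<circ> (\<lambda>t. t + 2 * pi)) has_vector_derivative nth_vector_derivative (Suc j) (circle_lift f) (t + 2 * pi)) (at t)"
    by simp
  moreover have "?D \<circ> (\<lambda>t. t + 2 * pi) = ?D" using Suc by auto
  ultimately have "(?D has_vector_derivative nth_vector_derivative (Suc j) (circle_lift f) (t + 2 * pi)) (at t)" by simp
  then show ?case
    using nth_vector_derivative_has_derivative[OF assms, of j t] vector_derivative_unique_at by blast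
qed

lemma continuous_on_nth_vector_derivative:
  assumes "smooth_on_circle f"
  shows "continuous_on A (nth_vector_derivative j (circle_lift f))"
  using nth_vector_derivative_has_derivative[OF assms]
  by (intro continuous_at_imp_continuous_on ballI has_vector_derivative_continuous)

lemma fourier_coeff_gevrey_M:
  assumes "smooth_on_circle f"
  shows "cmod (fourier_coeff (circle_lift f) k) * real_of_int \<bar>k\<bar> ^ j \<le> gevrey_M j f"
proof -
  have "fourier_coeff (nth_vector_derivative j (circle_lift f)) k = (\<i> * of_int k) ^ j * fourier_coeff (circle_lift f) k"
  proof (induction j)
    case 0
    then show ?case by (simp add: nth_vector_derivative_def)
  next
    case (Suc j)
    have "fourier_coeff (nth_vector_derivative (Suc j) (circle_lift f)) k
        = \<i> * of_int k * fourier_coeff (nth_vector_derivative j (circle_lift f)) k"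
      using nth_vector_derivative_periodic[OF assms, of j 0]
      by (intro fourier_coeff_derivative nth_vector_derivative_has_derivative continuous_on_nth_vector_derivative assms) simp
    then show ?case using Suc by (simp add: mult_ac)
  qed
  then have "cmod (fourier_coeff (nth_vector_derivative j (circle_lift f)) k) = real_of_int \<bar>k\<bar> ^ j * cmod (fourier_coeff (circle_lift f) k)"
    by (simp add: norm_mult norm_power)
  moreover have "cmod (fourier_coeff (nth_vector_derivative j (circle_lift f)) k) \<le> gevrey_M j f"
    unfolding gevrey_M_def by (intro norm_fourier_coeff_le continuous_on_nth_vector_derivative assms)
  ultimately show ?thesis by (simp add: mult.commute)
qed

text \<open>Locally f is its lift composed with a branch of the argument. \<open>Arg\<close> jumps
  on the negative real axis, where \<open>Arg (- z) + pi\<close> serves instead.\<close>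

lemma continuous_on_circle_if_lift:
  assumes "continuous_on UNIV (circle_lift f)"
  shows "continuous_on (sphere 0 1) f"
proof -
  have cont: "isCont (circle_lift f) t" for t
    using assms by (simp add: continuous_on_eq_continuous_at)
  have "continuous (at z within sphere 0 1) f" if z: "cmod z = 1" for z
  proof (cases "z \<in> \<real>\<^sub>\<le>\<^sub>0")
    case False
    have "continuous (at z within sphere 0 1) (\<lambda>z. circle_lift f (Arg z))"
      using isCont_o2[OF continuous_at_Arg[OF False] cont] by (rule continuous_at_imp_continuous_at_within)
    moreover have "circle_lift f (Arg z) = f z" if "cmod z = 1" for z
      using that cis_Arg[of z] by (cases "z = 0") (auto simp: circle_lift_def sgn_eq)
    ultimately show ?thesis
      using z by (auto elim!: continuous_transform_within[OF _ zero_less_one])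
  next
    case True
    moreover have "z \<noteq> 0" using z by auto
    ultimately have False: "- z \<notin> \<real>\<^sub>\<le>\<^sub>0" by (auto simp: complex_nonpos_Reals_iff complex_eq_iff)
    have "isCont (\<lambda>z. Arg (- z) + pi) z"
      by (intro continuous_intros isCont_o2[where f = uminus and g = Arg, OF _ continuous_at_Arg[OF False]])
    from isCont_o2[OF this cont] have "continuous (at z within sphere 0 1) (\<lambda>z. circle_lift f (Arg (- z) + pi))"
      by (rule continuous_at_imp_continuous_at_within)
    moreover have "circle_lift f (Arg (- z) + pi) = f z" if "cmod z = 1" for z
    proof -
      have "cis (Arg (- z)) = - z"
        using that cis_Arg[of "- z"] by (cases "z = 0") (auto simp: sgn_eq)
      then have "cis (Arg (- z) + pi) = z" by (simp flip: cis_mult)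
      then show ?thesis by (simp add: circle_lift_def)
    qed
    ultimately show ?thesis
      using z by (auto elim!: continuous_transform_within[OF _ zero_less_one])
  qed
  then show ?thesis by (simp add: continuous_on_eq_continuous_within)
qed

section \<open>Fourier inversion\<close>

lemma has_integral_cis_int:
  "((\<lambda>t. cis (of_int k * t)) has_integral (if k = 0 then of_real (2 * pi) else 0)) {0..2 * pi}"
proof (cases "k = 0")
  case True
  then show ?thesis using has_integral_const_real[of "1::complex" 0 "2 * pi"] by (simp add: scaleR_conv_of_real)
next
  case False
  have "((\<lambda>t. \<i> * of_real (of_int k) * cis (of_int k * t)) has_integral (cis (of_int k * (2 * pi)) - cis (of_int k * 0))) {0..2 * pi}"
    by (intro fundamental_theorem_of_calculus has_vector_derivative_cis_mult) simp
  then have "((\<lambda>t. \<i> * of_real (of_int k) * cis (of_int k * t)) has_integral 0) {0..2 * pi}"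
    by (simp add: cis_2pi_int)
  from has_integral_mult_right[OF this, of "1 / (\<i> * of_int k)"] show ?thesis
    using False by simp
qed

text \<open>The series converges uniformly to a continuous g, termwise integration gives g the
  Fourier coefficients of f, and f - g is then zero by uniqueness.\<close>

lemma fourier_inversion:
  assumes cont: "continuous_on (sphere 0 1) f"
    and sum: "(\<lambda>k. cmod (fourier_coeff (circle_lift f) k)) summable_on UNIV"
    and z: "cmod z = 1"
  shows "f z = (\<Sum>\<^sub>\<infinity>k. fourier_coeff (circle_lift f) k * z powi k)"
proof -
  define c where "c = fourier_coeff (circle_lift f)"
  define g where "g z = (\<Sum>\<^sub>\<infinity>k. c k * z powi k)" for z
  have unif: "uniform_limit (sphere 0 1) (\<lambda>X z. \<Sum>k\<in>X. c k * z powi k) g (finite_subsets_at_top UNIV)"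
    unfolding g_def by (rule Weierstrass_m_test_general[OF _ sum]) (simp add: c_def norm_mult norm_power_int)
  have contg: "continuous_on (sphere 0 1) g"
    by (rule uniform_limit_theorem[OF always_eventually unif]) (auto intro!: continuous_intros)
  have contf': "continuous_on {0..2 * pi} (\<lambda>t. f (cis t))" and contg': "continuous_on {0..2 * pi} (\<lambda>t. g (cis t))"
    by (auto intro!: continuous_on_compose2[OF cont] continuous_on_compose2[OF contg] continuous_intros)
  have int_g: "((\<lambda>t. g (cis t) * cis (of_int m * t)) has_integral (of_real (2 * pi) * c (- m))) {0..2 * pi}" for m
  proof -
    have "uniform_limit {0..2 * pi} (\<lambda>X t. \<Sum>k\<in>X. c k * cis t powi k * cis (of_int m * t))
        (\<lambda>t. (\<Sum>\<^sub>\<infinity>k. c k * cis t powi k * cis (of_int m * t))) (finite_subsets_at_top UNIV)"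
      by (rule Weierstrass_m_test_general[OF _ sum]) (simp add: c_def norm_mult norm_power_int)
    moreover have "(\<Sum>\<^sub>\<infinity>k. c k * cis t powi k * cis (of_int m * t)) = g (cis t) * cis (of_int m * t)" for t
      unfolding g_def by (rule infsum_cmult_left')
    moreover have "c k * cis t powi k * cis (of_int m * t) = c k * cis (of_int (k + m) * t)" for k t
      by (simp add: cis_power_int cis_mult algebra_simps)
    ultimately have u: "uniform_limit {0..2 * pi} (\<lambda>X t. \<Sum>k\<in>X. c k * cis (of_int (k + m) * t))
        (\<lambda>t. g (cis t) * cis (of_int m * t)) (finite_subsets_at_top UNIV)"
      by simp
    obtain I J where I: "\<And>X. ((\<lambda>t. \<Sum>k\<in>X. c k * cis (of_int (k + m) * t)) has_integral I X) {0..2 * pi}"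
      and J: "((\<lambda>t. g (cis t) * cis (of_int m * t)) has_integral J) {0..2 * pi}"
      and IJ: "(I \<longlongrightarrow> J) (finite_subsets_at_top UNIV)"
      by (rule uniform_limit_integral[OF u]) (auto intro!: continuous_intros)
    \<comment> \<open>Along the finite sets the integral is eventually constant: it takes its final
      value as soon as X contains - m.\<close>
    have IX: "I X = of_real (2 * pi) * c (- m)" if "finite X" "- m \<in> X" for X
    proof -
      have "((\<lambda>t. \<Sum>k\<in>X. c k * cis (of_int (k + m) * t)) has_integral (\<Sum>k\<in>X. c k * (if k + m = 0 then of_real (2 * pi) else 0))) {0..2 * pi}"
        using that by (intro has_integral_sum has_integral_mult_right has_integral_cis_int) 
      then have "I X = (\<Sum>k\<in>X. c k * (if k + m = 0 then of_real (2 * pi) else 0))"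
        using I has_integral_unique by blast
      also have "\<dots> = (\<Sum>k\<in>X. if k = - m then c k * of_real (2 * pi) else 0)"
        by (intro sum.cong) auto
      also have "\<dots> = of_real (2 * pi) * c (- m)"
        using that by (simp add: mult.commute)
      finally show ?thesis .
    qed
    have "\<forall>\<^sub>F X in finite_subsets_at_top UNIV. I X = of_real (2 * pi) * c (- m)"
      unfolding eventually_finite_subsets_at_top by (rule exI[of _ "{- m}"]) (use IX in auto)
    then have "(I \<longlongrightarrow> of_real (2 * pi) * c (- m)) (finite_subsets_at_top UNIV)"
      by (rule tendsto_eventually)
    then have "J = of_real (2 * pi) * c (- m)"
      using IJ tendsto_unique finite_subsets_at_top_neq_bot by blast
    then show ?thesis using J by simp
  qed
  have int_f: "((\<lambda>t. f (cis t) * cis (of_int m * t)) has_integral (of_real (2 * pi) * c (- m))) {0..2 * pi}" for m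
  proof -
    have "((\<lambda>t. f (cis t) * cis (of_int m * t)) has_integral (integral {0..2 * pi} (\<lambda>t. f (cis t) * cis (of_int m * t)))) {0..2 * pi}"
      by (intro integrable_integral integrable_continuous_real continuous_intros contf')
    then show ?thesis by (simp add: c_def fourier_coeff_def circle_lift_def)
  qed
  have "annihilates_circle (\<lambda>z. f z - g z)"
    unfolding annihilates_circle_def
  proof (intro conjI allI continuous_on_diff cont contg)
    fix m :: int
    show "((\<lambda>t. (f (cis t) - g (cis t)) * cis (of_int m * t)) has_integral 0) {0..2 * pi}"
      using has_integral_diff[OF int_f[of m] int_g[of m]] by (simp add: left_diff_distrib)
  qed
  from annihilates_circle_imp_zero[OF this z] show ?thesis by (simp add: g_def c_def)
qed

section \<open>Decay of the Fourier coefficients in a Gevrey class\<close>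

lemma summable_on_int_inverse_square: "(\<lambda>k::int. 1 / (real_of_int k)\<^sup>2) summable_on UNIV"
proof -
  have nat: "(\<lambda>n::nat. 1 / (real n)\<^sup>2) summable_on UNIV"
    using inverse_power_summable[of 2, where 'a = real]
    by (subst summable_on_UNIV_nonneg_real_iff) (auto simp: field_simps)
  have "(\<lambda>k::int. 1 / (real_of_int k)\<^sup>2) summable_on range int"
    using nat by (subst summable_on_reindex) (auto simp: o_def)
  moreover have "(\<lambda>k::int. 1 / (real_of_int k)\<^sup>2) summable_on range (\<lambda>n. - int n)"
    using nat by (subst summable_on_reindex) (auto simp: o_def inj_on_def)
  ultimately have "(\<lambda>k::int. 1 / (real_of_int k)\<^sup>2) summable_on range int \<union> range (\<lambda>n. - int n)"
    by (rule summable_on_union)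
  moreover have "range int \<union> range (\<lambda>n. - int n) = UNIV"
  proof (intro equalityI subsetI)
    fix k :: int
    show "k \<in> range int \<union> range (\<lambda>n. - int n)" by (cases k rule: int_cases2) auto
  qed simp
  ultimately show ?thesis by simp
qed

text \<open>For s = sqrt |k| the left-hand side is k^2 / 256, which makes exp (- sqrt |k|) summable
  over the integers.\<close>

lemma exp_ge_power4: "0 \<le> s \<Longrightarrow> (s / 4) ^ 4 \<le> exp (s :: real)"
proof -
  assume s: "0 \<le> s"
  have "(s / 4) ^ 4 \<le> exp (s / 4) ^ 4"
    using s exp_ge_add_one_self[of "s / 4"] by (intro power_mono) linarith+
  then show ?thesis using exp_of_nat_mult[of 4 "s / 4"] by simp
qed

text \<open>
  The bound \<open>\<bar>c k\<bar> * \<bar>k\<bar>^j \<le> (C * L j)^j\<close> is used with \<open>j\<close> of size \<open>(A + 1) * sqrt \<bar>k\<bar>\<close>.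
\<close>

lemma gevrey_fourier_coeff_summable:
  assumes smooth: "smooth_on_circle f" and L_ge: "\<And>j. real j \<le> L j"
    and L: "L \<in> o[at_top](\<lambda>j. (real j)\<^sup>2)" and f: "f \<in> gevrey_class L" and A: "0 \<le> A"
  shows "(\<lambda>k. cmod (fourier_coeff (circle_lift f) k) * exp (A * sqrt (real_of_int \<bar>k\<bar>))) summable_on UNIV"
proof -
  define c where "c k = cmod (fourier_coeff (circle_lift f) k)" for k
  obtain C where C: "0 < C" "\<And>j. gevrey_M j f \<le> (C * L j) ^ j"
    using f by (auto simp: gevrey_class_def)
  \<comment> \<open>The surplus over A leaves a factor exp (- sqrt |k|) for summability.\<close>
  define \<tau> where "\<tau> = A + 1"
  have \<tau>: "0 < \<tau>" using A by (simp add: \<tau>_def)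
  \<comment> \<open>Chosen so that j \<le> \<tau> sqrt |k|, with j large, gives C L_j \<le> C
    \<epsilon> j^2 \<le> |k| / e: each of the j factors of \<open>(C * L j) ^ j\<close> gains 1 / e
    over |k|.\<close>
  define \<epsilon> where "\<epsilon> = exp (- 1) / (C * \<tau>\<^sup>2)"
  have \<epsilon>: "0 < \<epsilon>" "C * \<epsilon> * \<tau>\<^sup>2 = exp (- 1)" using C \<tau> by (auto simp: \<epsilon>_def)
  obtain J where J: "\<And>j. J \<le> j \<Longrightarrow> L j \<le> \<epsilon> * (real j)\<^sup>2"
  proof -
    from landau_o.smallD[OF L \<epsilon>(1)] obtain J where J: "\<And>j. J \<le> j \<Longrightarrow> norm (L j) \<le> \<epsilon> * norm ((real j)\<^sup>2)"
      unfolding eventually_at_top_linorder by blast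
    show ?thesis
    proof (rule that)
      fix j assume "J \<le> j"
      from J[OF this] show "L j \<le> \<epsilon> * (real j)\<^sup>2" by (simp only: real_norm_def abs_power2 abs_le_iff)
    qed
  qed
  \<comment> \<open>For |k| \<ge> K the index j chosen below is at least J, where the bound on L
    applies; the final 1 excludes k = 0.\<close>
  define K where "K = nat \<lceil>((real J + 1) / \<tau>)\<^sup>2\<rceil> + 1"
  have bound: "c k * exp (A * sqrt (real_of_int \<bar>k\<bar>)) \<le> 256 * exp 1 * (1 / (real_of_int k)\<^sup>2)" if k: "int K \<le> \<bar>k\<bar>" for k
  proof -
    define s where "s = sqrt (real_of_int \<bar>k\<bar>)"
    have "1 \<le> K" by (simp add: K_def)
    then have k1: "1 \<le> \<bar>k\<bar>" using k by linarith
    have s2: "s\<^sup>2 = real_of_int \<bar>k\<bar>" by (simp add: s_def)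
    have s0: "0 < s" using k1 by (simp add: s_def)
    have "((real J + 1) / \<tau>)\<^sup>2 \<le> real K" unfolding K_def by linarith
    also have "\<dots> \<le> s\<^sup>2" unfolding s2 using k by linarith
    finally have "(real J + 1) / \<tau> \<le> s" using s0 by (rule power2_le_imp_le[OF _ less_imp_le])
    then have \<tau>s: "real J + 1 \<le> \<tau> * s" using \<tau> by (simp add: divide_le_eq mult.commute)
    define j where "j = nat \<lfloor>\<tau> * s\<rfloor>"
    have j: "real j \<le> \<tau> * s" "\<tau> * s \<le> real j + 1" "J \<le> j"
      using \<tau>s unfolding j_def by linarith+
    have "c k * real_of_int \<bar>k\<bar> ^ j \<le> (C * L j) ^ j"
      using fourier_coeff_gevrey_M[OF smooth, of k j] C(2)[of j] by (simp add: c_def)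
    also have "\<dots> \<le> (exp (- 1) * real_of_int \<bar>k\<bar>) ^ j"
    proof (rule power_mono)
      have "(real j)\<^sup>2 \<le> (\<tau> * s)\<^sup>2" using j(1) by (rule power_mono) simp
      then have "\<epsilon> * (real j)\<^sup>2 \<le> \<epsilon> * (\<tau> * s)\<^sup>2" using \<epsilon>(1) by simp
      then have "C * L j \<le> C * (\<epsilon> * (\<tau> * s)\<^sup>2)"
        using J[OF j(3)] C(1) by simp
      also have "\<dots> = (C * \<epsilon> * \<tau>\<^sup>2) * s\<^sup>2" by (simp add: power_mult_distrib)
      finally show "C * L j \<le> exp (- 1) * real_of_int \<bar>k\<bar>" unfolding \<epsilon>(2) s2 .
      show "0 \<le> C * L j" using C L_ge[of j] by (simp add: order.trans[OF of_nat_0_le_iff])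
    qed
    finally have "c k * real_of_int \<bar>k\<bar> ^ j \<le> exp (- real j) * real_of_int \<bar>k\<bar> ^ j"
      using exp_of_nat_mult[of j "- 1 :: real"] by (simp add: power_mult_distrib)
    then have "c k \<le> exp (- real j)"
      using k1 by (simp add: mult_le_cancel_right)
    also have "\<dots> \<le> exp (1 - \<tau> * s)" using j by simp
    finally have "c k * exp (A * s) \<le> exp (1 - \<tau> * s) * exp (A * s)" by (intro mult_right_mono) auto
    also have "\<dots> = exp 1 * (1 / exp s)"
    proof -
      have "1 - \<tau> * s + A * s = 1 - s" by (simp add: \<tau>_def algebra_simps)
      then show ?thesis unfolding exp_add[symmetric] by (simp only: exp_diff times_divide_eq_right mult_1_right)
    qed
    also have "\<dots> \<le> exp 1 * (1 / (s / 4) ^ 4)"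
      using s0 exp_ge_power4[of s] by (intro mult_left_mono divide_left_mono) auto
    also have "\<dots> = 256 * exp 1 * (1 / (s\<^sup>2)\<^sup>2)"
      by (simp add: power_divide power2_eq_square power4_eq_xxxx mult_ac)
    finally show ?thesis unfolding s2 by (simp add: s_def)
  qed
  have "(\<lambda>k. c k * exp (A * sqrt (real_of_int \<bar>k\<bar>))) summable_on {k. int K \<le> \<bar>k\<bar>}"
  proof (rule summable_on_comparison_test)
    show "(\<lambda>k. 256 * exp 1 * (1 / (real_of_int k)\<^sup>2)) summable_on {k. int K \<le> \<bar>k\<bar>}"
      by (intro summable_on_cmult_right summable_on_subset_banach[OF summable_on_int_inverse_square]) auto
  qed (use bound in \<open>auto simp: c_def\<close>)
  moreover have "(\<lambda>k. c k * exp (A * sqrt (real_of_int \<bar>k\<bar>))) summable_on {- int K..int K}"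
    by (rule summable_on_finite) simp
  ultimately have "(\<lambda>k. c k * exp (A * sqrt (real_of_int \<bar>k\<bar>))) summable_on {k. int K \<le> \<bar>k\<bar>} \<union> {- int K..int K}"
    by (rule summable_on_union)
  moreover have "{k. int K \<le> \<bar>k\<bar>} \<union> {- int K..int K} = UNIV" by auto
  ultimately show ?thesis by (simp add: c_def)
qed

section \<open>Polynomials that are small on the graph\<close>

text \<open>Gaussian elimination: a nonzero coefficient of equation i is the pivot that eliminates
  the unknown \<open>j0\<close> from the other equations, and y restores this unknown. If all
  coefficients of i vanish, that equation holds for every x.\<close>

lemma homogeneous_system:
  fixes a :: "'i \<Rightarrow> 'j \<Rightarrow> 'k::field"
  assumes "finite I" "finite J" "card I < card J"
  shows "\<exists>x. (\<exists>j\<in>J. x j \<noteq> 0) \<and> (\<forall>i\<in>I. (\<Sum>j\<in>J. a i j * x j) = 0)"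
  using assms
proof (induction I arbitrary: J a rule: finite_induct)
  case empty
  then have "J \<noteq> {}" by auto
  then show ?case by (auto intro!: exI[of _ "\<lambda>_. 1"])
next
  case (insert i I)
  show ?case
  proof (cases "\<forall>j\<in>J. a i j = 0")
    case True
    have "card I < card J" using insert by simp
    from insert.IH[OF insert.prems(1) this, of a] show ?thesis using True by auto
  next
    case False
    then obtain j0 where j0: "j0 \<in> J" "a i j0 \<noteq> 0" by blast
    define J' where "J' = J - {j0}"
    have J': "finite J'" "j0 \<notin> J'" "J = insert j0 J'" using insert.prems(1) j0(1) by (auto simp: J'_def)
    have "card I < card J'" using insert J' by simp
    from insert.IH[OF J'(1) this, of "\<lambda>k j. a k j - a k j0 * a i j / a i j0"]
    obtain x where x: "\<exists>j\<in>J'. x j \<noteq> 0" "\<forall>k\<in>I. (\<Sum>j\<in>J'. (a k j - a k j0 * a i j / a i j0) * x j) = 0" by blast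
    define y where "y = x(j0 := - (\<Sum>j\<in>J'. a i j * x j) / a i j0)"
    have y: "(\<Sum>j\<in>J. a k j * y j) = a k j0 * y j0 + (\<Sum>j\<in>J'. a k j * x j)" for k
    proof -
      have "(\<Sum>j\<in>J'. a k j * y j) = (\<Sum>j\<in>J'. a k j * x j)"
        using J'(2) by (intro sum.cong) (auto simp: y_def)
      then show ?thesis using J' by simp
    qed
    have "(\<Sum>j\<in>J. a k j * y j) = 0" if "k \<in> I" for k
    proof -
      have "0 = (\<Sum>j\<in>J'. a k j * x j - a k j0 / a i j0 * (a i j * x j))"
      proof -
        have E: "(a k j - a k j0 * a i j / a i j0) * x j = a k j * x j - a k j0 / a i j0 * (a i j * x j)" for j
          by (simp add: left_diff_distrib)
        show ?thesis using bspec[OF x(2) that] unfolding E by (rule sym)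
      qed
      also have "\<dots> = (\<Sum>j\<in>J'. a k j * x j) - a k j0 / a i j0 * (\<Sum>j\<in>J'. a i j * x j)"
        by (simp only: sum_subtractf sum_distrib_left)
      finally have "(\<Sum>j\<in>J'. a k j * x j) = a k j0 / a i j0 * (\<Sum>j\<in>J'. a i j * x j)" by (metis eq_iff_diff_eq_0)
      then show ?thesis unfolding y by (simp add: y_def)
    qed
    moreover have "(\<Sum>j\<in>J. a i j * y j) = 0" unfolding y using j0 by (simp add: y_def)
    moreover have "\<exists>j\<in>J. y j \<noteq> 0" using x(1) J' by (auto simp: y_def)
    ultimately show ?thesis by blast
  qed
qed

section \<open>Weighted Wiener algebras on the circle\<close>

lemma has_sum_sum:
  fixes g :: "'i \<Rightarrow> 'b \<Rightarrow> 'a::topological_comm_monoid_add"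
  assumes "\<And>i. i \<in> I \<Longrightarrow> (g i has_sum s i) A"
  shows "((\<lambda>x. \<Sum>i\<in>I. g i x) has_sum (\<Sum>i\<in>I. s i)) A"
  using assms by (induction I rule: infinite_finite_induct) (auto intro: has_sum_add)

text \<open>Membership of g in the Wiener algebra with weight \<phi>, with norm at most B. The
  coefficients are an explicit argument because the vanishing conditions will be imposed on
  them.\<close>

definition weighted_laurent :: "(int \<Rightarrow> real) \<Rightarrow> real \<Rightarrow> (complex \<Rightarrow> complex) \<Rightarrow> (int \<Rightarrow> complex) \<Rightarrow> bool" where
  "weighted_laurent \<phi> B g d \<longleftrightarrow> (\<exists>S\<le>B. ((\<lambda>k. cmod (d k) * \<phi> k) has_sum S) UNIV) \<and>
     (\<forall>z. cmod z = 1 \<longrightarrow> ((\<lambda>k. d k * z powi k) has_sum g z) UNIV)"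

text \<open>Indexing the pairs (k, l) by m = k + l and k leaves a double sum whose inner sum over k
  is the convolution coefficient.\<close>

lemma has_sum_convolution:
  fixes u v :: "int \<Rightarrow> 'a::{banach, real_normed_algebra}"
  assumes u: "(u has_sum U) UNIV" and v: "(v has_sum V) UNIV"
    and abs: "(\<lambda>(k, l). u k * v l) summable_on UNIV \<times> UNIV"
  shows "((\<lambda>(m, k). u k * v (m - k)) has_sum U * V) (UNIV \<times> UNIV)"
proof -
  have "((\<lambda>(k, l). u k * v l) has_sum U * V) (UNIV \<times> UNIV)"
  proof (rule has_sum_SigmaI)
    show "((\<lambda>l. case (k, l) of (k, l) \<Rightarrow> u k * v l) has_sum u k * V) UNIV" for k
      using has_sum_cmult_right[OF v] by simp
    show "((\<lambda>k. u k * V) has_sum U * V) UNIV" by (rule has_sum_cmult_left[OF u])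
  qed (rule abs)
  moreover have "((\<lambda>(m, k). u k * v (m - k)) has_sum U * V) (UNIV \<times> UNIV)
      \<longleftrightarrow> ((\<lambda>(k, l). u k * v l) has_sum U * V) (UNIV \<times> UNIV)"
    by (rule has_sum_reindex_bij_witness[where i = "\<lambda>(k, l). (k + l, k)" and j = "\<lambda>(m, k). (k, m - k)"]) auto
  ultimately show ?thesis by blast
qed

text \<open>Three weights occur because the cutoff moves with the number of factors. Weights \<ge> 1
  let the weighted sums control the unweighted ones, which give convergence on the circle.\<close>

lemma weighted_laurent_mult:
  assumes 1: "weighted_laurent \<phi>1 B1 g1 d1" and 2: "weighted_laurent \<phi>2 B2 g2 d2"
    and ge1: "\<And>k. 1 \<le> \<phi>1 k" "\<And>k. 1 \<le> \<phi>2 k" and \<phi>0: "\<And>k. 0 \<le> \<phi> k"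
    and submult: "\<And>k l. \<phi> (k + l) \<le> \<phi>1 k * \<phi>2 l"
  shows "\<exists>d. weighted_laurent \<phi> (B1 * B2) (\<lambda>z. g1 z * g2 z) d"
proof -
  define a where "a = (\<lambda>k. cmod (d1 k) * \<phi>1 k)"
  define b where "b = (\<lambda>k. cmod (d2 k) * \<phi>2 k)"
  obtain S1 where S1: "S1 \<le> B1" "(a has_sum S1) UNIV"
    using conjunct1[OF 1[unfolded weighted_laurent_def]] unfolding a_def by blast
  obtain S2 where S2: "S2 \<le> B2" "(b has_sum S2) UNIV"
    using conjunct1[OF 2[unfolded weighted_laurent_def]] unfolding b_def by blast
  have a0: "0 \<le> a k" and b0: "0 \<le> b k" for k
    using ge1[of k] by (auto simp: a_def b_def)
  have da: "cmod (d1 k) \<le> a k" and db: "cmod (d2 k) \<le> b k" for k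
    using ge1[of k] by (auto simp: a_def b_def mult_le_cancel_left1)
  have ab: "(\<lambda>(k, l). a k * b l) summable_on UNIV \<times> UNIV"
  proof (rule summable_on_SigmaI)
    show "((\<lambda>l. case (k, l) of (k, l) \<Rightarrow> a k * b l) has_sum a k * S2) UNIV" for k
      using has_sum_cmult_right[OF S2(2)] by simp
    show "(\<lambda>k. a k * S2) summable_on UNIV"
      by (rule summable_on_cmult_left[OF has_sum_imp_summable[OF S1(2)]])
  qed (simp add: a0 b0)
  have conv: "((\<lambda>(m, k). a k * b (m - k)) has_sum S1 * S2) (UNIV \<times> UNIV)"
    by (rule has_sum_convolution[OF S1(2) S2(2) ab])
  have inner: "(\<lambda>k. a k * b (m - k)) summable_on UNIV" for m
    using summable_on_SigmaD1[OF has_sum_imp_summable[OF conv]] by simp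
  define h where "h m = (\<Sum>\<^sub>\<infinity>k. a k * b (m - k))" for m
  have h: "(h has_sum S1 * S2) UNIV"
  proof (rule has_sum_SigmaD[OF conv])
    show "((\<lambda>k. case (m, k) of (m, k) \<Rightarrow> a k * b (m - k)) has_sum h m) UNIV" for m
      using has_sum_infsum[OF inner] by (simp add: h_def)
  qed
  define d where "d m = (\<Sum>\<^sub>\<infinity>k. d1 k * d2 (m - k))" for m
  have d: "((\<lambda>k. d1 k * d2 (m - k)) has_sum d m) UNIV" for m
    unfolding d_def
  proof (rule has_sum_infsum[OF abs_summable_summable[OF Infinite_Sum.abs_summable_on_comparison_test'[OF inner]]])
    show "cmod (d1 k * d2 (m - k)) \<le> a k * b (m - k)" for k
      unfolding norm_mult by (intro mult_mono da db a0) simp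
  qed
  have le: "cmod (d m) * \<phi> m \<le> h m" for m
  proof -
    have "cmod (d m * of_real (\<phi> m)) \<le> h m"
    proof (rule norm_infsum_le)
      show "((\<lambda>k. d1 k * d2 (m - k) * of_real (\<phi> m)) has_sum d m * of_real (\<phi> m)) UNIV"
        by (intro has_sum_cmult_left d)
      show "((\<lambda>k. a k * b (m - k)) has_sum h m) UNIV"
        unfolding h_def by (intro has_sum_infsum inner)
      fix k
      have "cmod (d1 k * d2 (m - k) * of_real (\<phi> m)) = cmod (d1 k) * cmod (d2 (m - k)) * \<phi> m"
        using \<phi>0 by (simp add: norm_mult)
      also have "\<dots> \<le> cmod (d1 k) * cmod (d2 (m - k)) * (\<phi>1 k * \<phi>2 (m - k))"
        using submult[of k "m - k"] by (intro mult_left_mono) auto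
      finally show "cmod (d1 k * d2 (m - k) * of_real (\<phi> m)) \<le> a k * b (m - k)"
        by (simp add: a_def b_def mult_ac)
    qed
    then show ?thesis using \<phi>0 by (simp add: norm_mult)
  qed
  have sum_d: "(\<lambda>m. cmod (d m) * \<phi> m) summable_on UNIV"
    using has_sum_imp_summable[OF h] by (rule summable_on_comparison_test) (use le \<phi>0 in auto)
  have "(\<Sum>\<^sub>\<infinity>m. cmod (d m) * \<phi> m) \<le> S1 * S2"
    using infsum_mono[OF sum_d has_sum_imp_summable[OF h]] le infsumI[OF h] by auto
  also have "\<dots> \<le> B1 * B2"
    using S1 S2 has_sum_nonneg[OF S1(2)] has_sum_nonneg[OF S2(2)] a0 b0 by (intro mult_mono) auto
  finally have B: "\<exists>S\<le>B1 * B2. ((\<lambda>m. cmod (d m) * \<phi> m) has_sum S) UNIV"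
    using has_sum_infsum[OF sum_d] by blast
  have "((\<lambda>m. d m * z powi m) has_sum g1 z * g2 z) UNIV" if z: "cmod z = 1" for z
  proof -
    have z0: "z \<noteq> 0" using z by auto
    have "(\<lambda>(k, l). d1 k * z powi k * (d2 l * z powi l)) summable_on UNIV \<times> UNIV"
      by (rule abs_summable_summable[OF Infinite_Sum.abs_summable_on_comparison_test'[OF ab]])
        (use z in \<open>auto simp: norm_mult norm_power_int intro!: mult_mono da db a0\<close>)
    from has_sum_convolution[OF _ _ this]
    have "((\<lambda>(m, k). d1 k * z powi k * (d2 (m - k) * z powi (m - k))) has_sum g1 z * g2 z) (UNIV \<times> UNIV)"
      using 1 2 z unfolding weighted_laurent_def by blast
    moreover have "d1 k * z powi k * (d2 (m - k) * z powi (m - k)) = d1 k * d2 (m - k) * z powi m" for k m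
      using power_int_add[of z k "m - k"] z0 by (simp add: mult_ac)
    ultimately have "((\<lambda>(m, k). d1 k * d2 (m - k) * z powi m) has_sum g1 z * g2 z) (UNIV \<times> UNIV)" by simp
    then show ?thesis
    proof (rule has_sum_SigmaD)
      show "((\<lambda>k. case (m, k) of (m, k) \<Rightarrow> d1 k * d2 (m - k) * z powi m) has_sum d m * z powi m) UNIV" for m
        using has_sum_cmult_left[OF d] by simp
    qed
  qed
  then show ?thesis using B unfolding weighted_laurent_def by blast
qed

text \<open>The weight is 1 for |k| \<le> b * N: b counts the factors z and f in a product, and each
  of them grants N further frequencies free of charge.\<close>

definition sqrt_weight :: "real \<Rightarrow> nat \<Rightarrow> nat \<Rightarrow> int \<Rightarrow> real" where
  "sqrt_weight A N b k = exp (A * sqrt (max 0 (real_of_int \<bar>k\<bar> - real (b * N))))"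

lemma sqrt_weight_ge_1: "0 \<le> A \<Longrightarrow> 1 \<le> sqrt_weight A N b k"
  by (simp add: sqrt_weight_def)

lemma sqrt_weight_add:
  assumes "0 \<le> A"
  shows "sqrt_weight A N (b + c) (k + l) \<le> sqrt_weight A N b k * sqrt_weight A N c l"
proof -
  define x where "x = max 0 (real_of_int \<bar>k\<bar> - real (b * N))"
  define y where "y = max 0 (real_of_int \<bar>l\<bar> - real (c * N))"
  have "real_of_int \<bar>k + l\<bar> \<le> real_of_int \<bar>k\<bar> + real_of_int \<bar>l\<bar>" by linarith
  then have "max 0 (real_of_int \<bar>k + l\<bar> - real ((b + c) * N)) \<le> x + y"
    by (simp add: x_def y_def distrib_right)
  then have "sqrt (max 0 (real_of_int \<bar>k + l\<bar> - real ((b + c) * N))) \<le> sqrt (x + y)" by simp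
  also have "\<dots> \<le> sqrt x + sqrt y" by (rule sqrt_add_le_add_sqrt) (auto simp: x_def y_def)
  finally have "A * sqrt (max 0 (real_of_int \<bar>k + l\<bar> - real ((b + c) * N))) \<le> A * (sqrt x + sqrt y)"
    using assms by (rule mult_left_mono)
  then show ?thesis
    unfolding sqrt_weight_def x_def[symmetric] y_def[symmetric] exp_add[symmetric]
    by (simp add: distrib_left)
qed

text \<open>\<open>1 \<le> N\<close> puts the frequency a into the free range up to a * N, so z^a
  has norm 1 whatever A is.\<close>

lemma weighted_laurent_monomial:
  assumes "1 \<le> N"
  shows "weighted_laurent (sqrt_weight A N a) 1 (\<lambda>z. z ^ a) (\<lambda>k. if k = int a then 1 else 0)"
proof -
  have w: "sqrt_weight A N a (int a) = 1"
    using assms by (simp add: sqrt_weight_def mult_le_cancel_left1)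
  have "((\<lambda>k. cmod (if k = int a then 1 else 0) * sqrt_weight A N a k) has_sum 1) {int a}"
    using has_sum_finite[of "{int a}" "\<lambda>k. cmod (if k = int a then 1 else 0) * sqrt_weight A N a k"] w by simp
  then have 1: "((\<lambda>k. cmod (if k = int a then 1 else 0) * sqrt_weight A N a k) has_sum 1) UNIV"
    by (rule has_sum_cong_neutral[THEN iffD1, rotated -1]) auto
  have "((\<lambda>k. (if k = int a then 1 else 0) * z powi k) has_sum z ^ a) {int a}" for z :: complex
    using has_sum_finite[of "{int a}" "\<lambda>k. (if k = int a then 1 else 0) * z powi k"] by simp
  then have 2: "((\<lambda>k. (if k = int a then 1 else 0) * z powi k) has_sum z ^ a) UNIV" for z :: complex
    by (rule has_sum_cong_neutral[THEN iffD1, rotated -1]) auto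
  show ?thesis unfolding weighted_laurent_def using 1 2 by blast
qed

lemma weighted_laurent_monomials:
  assumes A: "0 \<le> A" and N: "1 \<le> N" and f: "weighted_laurent (sqrt_weight A N 1) F f c"
  shows "\<exists>d. weighted_laurent (sqrt_weight A N (a + b)) (F ^ b) (\<lambda>z. z ^ a * f z ^ b) d"
proof (induction b)
  case 0
  then show ?case using weighted_laurent_monomial[OF N, of A a] by auto
next
  case (Suc b)
  then obtain d where d: "weighted_laurent (sqrt_weight A N (a + b)) (F ^ b) (\<lambda>z. z ^ a * f z ^ b) d" by blast
  have "\<exists>d. weighted_laurent (sqrt_weight A N (a + b + 1)) (F ^ b * F) (\<lambda>z. z ^ a * f z ^ b * f z) d"
    by (rule weighted_laurent_mult[OF d f sqrt_weight_ge_1[OF A] sqrt_weight_ge_1[OF A] _ sqrt_weight_add[OF A]])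
      (simp add: sqrt_weight_def)
  then show ?case by (simp add: mult_ac)
qed

text \<open>Ignoring the first \<open>N\<close> frequencies keeps the weighted norm bounded independently of \<open>A\<close>.\<close>

lemma weighted_laurent_shifted_weight:
  fixes c :: "int \<Rightarrow> complex"
  assumes A: "0 \<le> A"
    and sum0: "(\<lambda>k. cmod (c k)) summable_on UNIV"
    and sumA: "(\<lambda>k. cmod (c k) * exp (A * sqrt (real_of_int \<bar>k\<bar>))) summable_on UNIV"
    and f: "\<And>z. cmod z = 1 \<Longrightarrow> ((\<lambda>k. c k * z powi k) has_sum f z) UNIV"
  shows "\<exists>N\<ge>1. weighted_laurent (sqrt_weight A N 1) ((\<Sum>\<^sub>\<infinity>k. cmod (c k)) + 1) f c"
proof -
  define v where "v k = cmod (c k) * exp (A * sqrt (real_of_int \<bar>k\<bar>))" for k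
  define T where "T = (\<Sum>\<^sub>\<infinity>k. v k)"
  have T: "(v has_sum T) UNIV" unfolding T_def v_def using sumA by (rule has_sum_infsum)
  \<comment> \<open>X carries the weighted sum up to an error of 1. Once N covers X, its frequencies
    have weight 1 and are charged to the unweighted sum; the others add at most 1.\<close>
  obtain X where X: "finite X" "dist (sum v X) T \<le> 1"
    using has_sum_finite_approximation[OF T, of 1] by auto
  define N where "N = nat (Max (insert 1 (abs ` X)))"
  have N: "1 \<le> N" "\<And>k. k \<in> X \<Longrightarrow> \<bar>k\<bar> \<le> int N"
  proof -
    have 1: "1 \<le> Max (insert 1 (abs ` X))" using X(1) by (intro Max_ge) auto
    then show "1 \<le> N" by (simp add: N_def)
    fix k assume "k \<in> X"
    then have "\<bar>k\<bar> \<le> Max (insert 1 (abs ` X))" using X(1) by (intro Max_ge) auto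
    then show "\<bar>k\<bar> \<le> int N" using 1 unfolding N_def by linarith
  qed
  have "(v has_sum (T - sum v X)) (UNIV - X)"
    by (intro has_sum_Diff T has_sum_finite X) auto
  then have tail: "((\<lambda>k. if k \<in> X then 0 else v k) has_sum (T - sum v X)) UNIV"
    by (rule has_sum_cong_neutral[THEN iffD1, rotated -1]) auto
  have c_sum: "((\<lambda>k. cmod (c k)) has_sum (\<Sum>\<^sub>\<infinity>k. cmod (c k))) UNIV"
    using sum0 by (rule has_sum_infsum)
  have both: "((\<lambda>k. cmod (c k) + (if k \<in> X then 0 else v k)) has_sum (\<Sum>\<^sub>\<infinity>k. cmod (c k)) + (T - sum v X)) UNIV"
    by (intro has_sum_add c_sum tail)
  have le: "cmod (c k) * sqrt_weight A N 1 k \<le> cmod (c k) + (if k \<in> X then 0 else v k)" for k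
  proof (cases "k \<in> X")
    case True
    then have "real_of_int \<bar>k\<bar> \<le> real N" using N(2) by (metis of_int_le_iff of_int_of_nat_eq)
    then show ?thesis using True by (simp add: sqrt_weight_def)
  next
    case False
    have "sqrt (max 0 (real_of_int \<bar>k\<bar> - real (1 * N))) \<le> sqrt (real_of_int \<bar>k\<bar>)" by simp
    then have "A * sqrt (max 0 (real_of_int \<bar>k\<bar> - real (1 * N))) \<le> A * sqrt (real_of_int \<bar>k\<bar>)"
      using A by (rule mult_left_mono)
    then have "cmod (c k) * sqrt_weight A N 1 k \<le> v k"
      unfolding v_def sqrt_weight_def by (intro mult_left_mono) auto
    then show ?thesis using False by (simp add: add_increasing)
  qed
  have summ: "(\<lambda>k. cmod (c k) * sqrt_weight A N 1 k) summable_on UNIV"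
    using has_sum_imp_summable[OF both] by (rule summable_on_comparison_test) (use le in \<open>auto simp: sqrt_weight_def\<close>)
  have "(\<Sum>\<^sub>\<infinity>k. cmod (c k) * sqrt_weight A N 1 k) \<le> (\<Sum>\<^sub>\<infinity>k. cmod (c k)) + (T - sum v X)"
    using infsum_mono[OF summ has_sum_imp_summable[OF both]] le infsumI[OF both] by auto
  also have "\<dots> \<le> (\<Sum>\<^sub>\<infinity>k. cmod (c k)) + 1" using X(2) by (simp add: dist_real_def)
  finally have "weighted_laurent (sqrt_weight A N 1) ((\<Sum>\<^sub>\<infinity>k. cmod (c k)) + 1) f c"
    unfolding weighted_laurent_def using has_sum_infsum[OF summ] f by blast
  then show ?thesis using N(1) by blast
qed

section \<open>Removal of the low frequencies\<close>

lemma exists_small_polynomial: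
  fixes f :: "complex \<Rightarrow> complex" and c :: "int \<Rightarrow> complex"
  assumes decay: "\<And>A. 0 \<le> A \<Longrightarrow> (\<lambda>k. cmod (c k) * exp (A * sqrt (real_of_int \<bar>k\<bar>))) summable_on UNIV"
    and f: "\<And>z. cmod z = 1 \<Longrightarrow> ((\<lambda>k. c k * z powi k) has_sum f z) UNIV"
  shows "\<exists>n\<ge>1. \<exists>p. (\<forall>a b. cmod (p a b) \<le> 1) \<and> (\<exists>a\<le>n. \<exists>b\<le>n. cmod (p a b) = 1) \<and>
    (\<forall>z. cmod z = 1 \<longrightarrow> cmod (eval2 n p z (f z)) \<le> exp (- A0 * real n))"
proof -
  have sum0: "(\<lambda>k. cmod (c k)) summable_on UNIV" using decay[of 0] by simp
  define F where "F = (\<Sum>\<^sub>\<infinity>k. cmod (c k)) + 1"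
  have F: "1 \<le> F" unfolding F_def using infsum_nonneg[of UNIV "\<lambda>k. cmod (c k)"] by simp
  \<comment> \<open>Balance of exponents: the gain is A n / 2, the losses are 2 n for the (n + 1)^2
    terms and n ln F for the norms, and A0 n must remain. There is no circularity, since F is fixed
    before A.\<close>
  define A where "A = 2 * (max 0 A0 + 2 + ln F)"
  have A: "0 \<le> A" using F by (simp add: A_def)
  obtain N where N: "1 \<le> N" and wf: "weighted_laurent (sqrt_weight A N 1) F f c"
    using weighted_laurent_shifted_weight[OF A sum0 decay[OF A] f] unfolding F_def by blast
  \<comment> \<open>Then n^2 = 8 n N + 2 n, so m - 2 n N, what all cutoffs leave of the first m
    frequencies, is still at least (n / 2)^2.\<close>
  define n where "n = 8 * N + 2"
  define m where "m = n\<^sup>2 div 2"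
  define D where "D a b = (SOME d. weighted_laurent (sqrt_weight A N (a + b)) (F ^ b) (\<lambda>z. z ^ a * f z ^ b) d)" for a b
  have D: "weighted_laurent (sqrt_weight A N (a + b)) (F ^ b) (\<lambda>z. z ^ a * f z ^ b) (D a b)" for a b
    unfolding D_def using someI_ex[OF weighted_laurent_monomials[OF A N wf]] .
  define I where "I = {- int m..int m}"
  define J where "J = {..n} \<times> {..n}"
  \<comment> \<open>At most n^2 + 1 equations stand against (n + 1)^2 unknowns.\<close>
  have "card I < card J"
  proof -
    have "2 * m \<le> n\<^sup>2" by (simp add: m_def)
    moreover have "card I = 2 * m + 1" by (simp add: I_def)
    moreover have "card J = n\<^sup>2 + 2 * n + 1" by (simp add: J_def power2_eq_square)
    moreover have "1 \<le> n" by (simp add: n_def)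
    ultimately show ?thesis by linarith
  qed
  moreover have "finite I" "finite J" by (simp_all add: I_def J_def)
  ultimately obtain x where x: "\<exists>j\<in>J. x j \<noteq> 0" "\<And>k. k \<in> I \<Longrightarrow> (\<Sum>j\<in>J. D (fst j) (snd j) k * x j) = 0"
    using homogeneous_system[of I J "\<lambda>k j. D (fst j) (snd j) k"] by blast
  define M where "M = Max ((\<lambda>j. cmod (x j)) ` J)"
  have finJ: "finite J" "J \<noteq> {}" by (auto simp: J_def)
  have x_le: "cmod (x j) \<le> M" if "j \<in> J" for j
    unfolding M_def using finJ that by (intro Max_ge) auto
  have M: "0 < M" using x(1) x_le by (metis less_le_trans zero_less_norm_iff)
  have "M \<in> (\<lambda>j. cmod (x j)) ` J" unfolding M_def using finJ by (intro Max_in) auto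
  then obtain a0 b0 where ab0: "a0 \<le> n" "b0 \<le> n" "cmod (x (a0, b0)) = M" by (auto simp: J_def)
  define p where "p a b = (if (a, b) \<in> J then x (a, b) / of_real M else 0)" for a b
  have p_le: "cmod (p a b) \<le> 1" for a b
    using x_le[of "(a, b)"] M by (simp add: p_def norm_divide)
  have p1: "cmod (p a0 b0) = 1" using ab0 M by (simp add: p_def J_def norm_divide)
  define d where "d k = (\<Sum>a\<le>n. \<Sum>b\<le>n. p a b * D a b k)" for k
  have d0: "d k = 0" if "k \<in> I" for k
  proof -
    have "d k = (\<Sum>j\<in>J. D (fst j) (snd j) k * x j) / of_real M"
      unfolding d_def sum.cartesian_product J_def[symmetric] sum_divide_distrib
      by (rule sum.cong) (auto simp: p_def)
    then show ?thesis using x(2)[OF that] by simp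
  qed
  \<comment> \<open>A common lower bound for the weights outside I, where |k| \<ge> m, since a + b
    \<le> 2 n. Division by it turns the weighted norms into a bound for the surviving
    series.\<close>
  define W where "W = exp (A * sqrt (real m - real (2 * n * N)))"
  have m_ge: "(real n / 2)\<^sup>2 \<le> real m - real (2 * n * N)"
  proof -
    have "2 * m \<ge> n\<^sup>2 - 1" unfolding m_def by linarith
    then have "(real n)\<^sup>2 - 1 \<le> 2 * real m" by (simp flip: of_nat_power) 
    moreover have "(real n)\<^sup>2 = 8 * (real n * real N) + 2 * real n" by (simp add: n_def power2_eq_square algebra_simps)
    moreover have "1 \<le> real n" by (simp add: n_def)
    moreover have "real (2 * n * N) = 2 * (real n * real N)" "(real n / 2)\<^sup>2 = (real n)\<^sup>2 / 4"
      by (simp_all add: power_divide)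
    ultimately show ?thesis by linarith
  qed
  have W_ge: "exp (A * (real n / 2)) \<le> W"
    unfolding W_def exp_le_cancel_iff by (rule mult_left_mono[OF real_le_rsqrt[OF m_ge] A])
  have W_le: "W \<le> sqrt_weight A N (a + b) k" if "k \<notin> I" "a \<le> n" "b \<le> n" for k a b
  proof -
    have "int m \<le> \<bar>k\<bar>" using that(1) by (auto simp: I_def)
    then have "real m \<le> real_of_int \<bar>k\<bar>" by linarith
    moreover have "real ((a + b) * N) \<le> real (2 * n * N)"
      using that by (intro of_nat_mono mult_right_mono) auto
    ultimately have "sqrt (real m - real (2 * n * N)) \<le> sqrt (max 0 (real_of_int \<bar>k\<bar> - real ((a + b) * N)))"
      by (intro real_sqrt_le_mono) linarith
    then show ?thesis unfolding W_def sqrt_weight_def using A by (simp add: mult_left_mono)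
  qed
  have W0: "0 < W" by (simp add: W_def)
  have small: "cmod (eval2 n p z (f z)) \<le> exp (- A0 * real n)" if z: "cmod z = 1" for z
  proof -
    define S where "S a b = (SOME s. s \<le> F ^ b \<and> ((\<lambda>k. cmod (D a b k) * sqrt_weight A N (a + b) k) has_sum s) UNIV)" for a b
    have S: "S a b \<le> F ^ b" "((\<lambda>k. cmod (D a b k) * sqrt_weight A N (a + b) k) has_sum S a b) UNIV" for a b
      using someI_ex[of "\<lambda>s. s \<le> F ^ b \<and> ((\<lambda>k. cmod (D a b k) * sqrt_weight A N (a + b) k) has_sum s) UNIV"] D[of a b]
      unfolding weighted_laurent_def S_def by blast+
    have "((\<lambda>k. \<Sum>a\<le>n. \<Sum>b\<le>n. p a b * (D a b k * z powi k)) has_sum (\<Sum>a\<le>n. \<Sum>b\<le>n. p a b * (z ^ a * f z ^ b))) UNIV"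
      by (intro has_sum_sum has_sum_cmult_right) (use D z in \<open>auto simp: weighted_laurent_def\<close>)
    then have lhs: "((\<lambda>k. d k * z powi k) has_sum eval2 n p z (f z)) UNIV"
      by (simp add: d_def eval2_def sum_distrib_right mult.assoc)
    have rhs: "((\<lambda>k. (\<Sum>a\<le>n. \<Sum>b\<le>n. cmod (D a b k) * sqrt_weight A N (a + b) k) / W) has_sum (\<Sum>a\<le>n. \<Sum>b\<le>n. S a b) / W) UNIV"
      unfolding divide_inverse by (intro has_sum_cmult_left has_sum_sum S)
    have "cmod (eval2 n p z (f z)) \<le> (\<Sum>a\<le>n. \<Sum>b\<le>n. S a b) / W"
    proof (rule norm_infsum_le[OF lhs rhs])
      fix k
      show "cmod (d k * z powi k) \<le> (\<Sum>a\<le>n. \<Sum>b\<le>n. cmod (D a b k) * sqrt_weight A N (a + b) k) / W"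
      proof (cases "k \<in> I")
        case True
        then show ?thesis using W0
          by (auto simp: d0 sqrt_weight_def intro!: divide_nonneg_pos sum_nonneg)
      next
        case False
        have "cmod (d k) \<le> (\<Sum>a\<le>n. \<Sum>b\<le>n. cmod (D a b k) * sqrt_weight A N (a + b) k / W)"
          unfolding d_def
        proof (intro order.trans[OF norm_sum] sum_mono)
          fix a b assume "a \<in> {..n}" "b \<in> {..n}"
          then have "1 \<le> sqrt_weight A N (a + b) k / W" using W_le[OF False, of a b] W0 by simp
          then have "cmod (D a b k) * 1 \<le> cmod (D a b k) * (sqrt_weight A N (a + b) k / W)"
            by (rule mult_left_mono) simp
          moreover have "cmod (p a b) * cmod (D a b k) \<le> 1 * cmod (D a b k)"
            by (intro mult_right_mono p_le) simp
          ultimately show "cmod (p a b * D a b k) \<le> cmod (D a b k) * sqrt_weight A N (a + b) k / W"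
            by (simp add: norm_mult)
        qed
        then show ?thesis using z by (simp add: norm_mult norm_power_int sum_divide_distrib)
      qed
    qed
    also have "\<dots> \<le> (\<Sum>a\<le>n. \<Sum>b\<le>n. F ^ n) / W"
      using W0 F by (intro divide_right_mono sum_mono order.trans[OF S(1)] power_increasing) auto
    also have "\<dots> = (1 + real n) * (1 + real n) * F ^ n / W" by simp
    also have "\<dots> \<le> exp (real n) * exp (real n) * F ^ n / W"
      using W0 F by (intro divide_right_mono mult_right_mono mult_mono exp_ge_add_one_self) auto
    also have "\<dots> = exp (2 * real n + real n * ln F) / W"
    proof -
      have "F ^ n = exp (real n * ln F)" using F by (simp add: exp_of_nat_mult)
      then show ?thesis by (simp flip: exp_add)
    qed
    also have "\<dots> \<le> exp (2 * real n + real n * ln F) / exp (A * (real n / 2))"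
      using W_ge W0 by (intro divide_left_mono) auto
    also have "\<dots> = exp (- max 0 A0 * real n)"
      unfolding exp_diff[symmetric] by (simp add: A_def algebra_simps)
    also have "\<dots> \<le> exp (- A0 * real n)" by (simp add: mult_right_mono)
    finally show ?thesis .
  qed
  have "1 \<le> n" by (simp add: n_def)
  then show ?thesis using p_le p1 ab0 small by blast
qed

theorem theorem1p2:
  fixes f :: "complex \<Rightarrow> complex" and L :: "nat \<Rightarrow> real"
  assumes "smooth_on_circle f"
    and "gevrey_sequence L"
    and "\<And>j. real j \<le> L j"
    and "L \<in> o[at_top](\<lambda>j. (real j)\<^sup>2)"
    and "f \<in> gevrey_class L"
  shows "pluripolar (circle_graph f)"
proof (rule pluripolar_if_small_polynomials)
  fix A :: real
  define c where "c = fourier_coeff (circle_lift f)"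
  have decay: "(\<lambda>k. cmod (c k) * exp (A * sqrt (real_of_int \<bar>k\<bar>))) summable_on UNIV" if "0 \<le> A" for A
    unfolding c_def by (intro gevrey_fourier_coeff_summable[of f L] assms that)
  have sum: "(\<lambda>k. cmod (c k)) summable_on UNIV" using decay[of 0] by simp
  have "nth_vector_derivative 0 (circle_lift f) = circle_lift f"
    by (simp add: nth_vector_derivative_def)
  then have cont: "continuous_on (sphere 0 1) f"
    using continuous_on_nth_vector_derivative[OF assms(1), of UNIV 0]
    by (intro continuous_on_circle_if_lift) simp
  have "((\<lambda>k. c k * z powi k) has_sum f z) UNIV" if z: "cmod z = 1" for z
  proof -
    have "(\<lambda>k. norm (c k * z powi k)) summable_on UNIV"
      using sum z by (simp add: norm_mult norm_power_int)
    then have "(\<lambda>k. c k * z powi k) summable_on UNIV" by (rule abs_summable_summable)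
    then show ?thesis
      using fourier_inversion[OF cont sum[unfolded c_def] z] by (simp add: c_def has_sum_infsum)
  qed
  from exists_small_polynomial[OF decay this, of A]
  obtain n p where np: "n \<ge> 1" "\<forall>a b. cmod (p a b) \<le> 1" "\<exists>a\<le>n. \<exists>b\<le>n. cmod (p a b) = 1"
    "\<forall>z. cmod z = 1 \<longrightarrow> cmod (eval2 n p z (f z)) \<le> exp (- A * real n)"
    by blast
  have "\<forall>x\<in>circle_graph f. cmod (eval2 n p (x $ 1) (x $ 2)) \<le> exp (- A * real n)"
    using np(4) by (auto simp: circle_graph_def)
  with np show "\<exists>n\<ge>1. \<exists>p. (\<forall>a b. cmod (p a b) \<le> 1) \<and> (\<exists>a\<le>n. \<exists>b\<le>n. cmod (p a b) = 1) \<and>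
      (\<forall>x\<in>circle_graph f. cmod (eval2 n p (x $ 1) (x $ 2)) \<le> exp (- A * real n))"
    by blast
qed

end
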